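(* There is a constant $C$ such that for every integer $N \ge 2$ there exists a partially restricted glue tile assembly system (prgTAS) $\mathcal{T}_N = (T_N, \sigma, 1)$ with $|T_N| \le C\log N$ such that, for every value $-m$ ($m \ge 1$) of the strength of its unique negative glue, $\mathcal{T}_N$ is directed and the square $S_N = \{0,1,\ldots,N-1\} \times \{0,1,\ldots,N-1\}$ strictly self-assembles in $\mathcal{T}_N$.
   Context: Abstract Tile Assembly Model (aTAM) in $\mathbb{Z}^2$. A tile type is a unit square that can be translated but not rotated; each of its four sides carries a glue, consisting of a label from a fixed alphabet and an integer strength. Two tiles at adjacent positions interact with strength $s$ iff the glues on their abutting sides have the same label and strength $s$; otherwise they interact with strength $0$. An assembly is a partial function $\alpha:\mathbb{Z}^2 \rightharpoonup T$. A TAS is a triple $(T,\sigma,\tau)$ with finite tile set $T$, finite seed assembly $\sigma$ (here a single tile), temperature $\tau$. Growth is irreversible: starting from $\sigma$, tiles are added one at a time; a tile may be placed at an empty position iff the sum of its interaction strengths (positive and negative) with the tiles already at neighboring positions is at least $\tau$; placed tiles never detach. An assembly is terminal if no tile can be added; the TAS is directed if it has exactly one terminal assembly. A set $X$ strictly self-assembles if every terminal assembly has domain exactly $X$. A TAS $(T,\sigma,1)$ is partially glue restricted (prgTAS) if (1) every positive glue strength is $1$, (2) the glue function is diagonal (a glue interacts only with an identical glue), and (3) there is exactly one glue type of negative strength, whose strength is only guaranteed to be some integer $\le -1$ (it may be $-1,-2,-3,\ldots$). Logarithms are base 2. *)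

theory Defs
  imports Complex_Main
begin

text \<open>Abstract Tile Assembly Model in Z^2. Glue labels are natural numbers.
A tile type assigns a glue label to each of its four sides. The strength of a
glue is given by a strength function on labels; two abutting sides interact
with the strength of their common label iff their labels coincide (diagonal
glue function), and with strength 0 otherwise.\<close>

datatype side = North | East | South | West

type_synonym tile = "side \<Rightarrow> nat"
type_synonym pos = "int \<times> int"
type_synonym assembly = "pos \<Rightarrow> tile option"

definition glue_int :: "(nat \<Rightarrow> int) \<Rightarrow> nat \<Rightarrow> nat \<Rightarrow> int" where
  "glue_int str a b = (if a = b then str a else 0)"

definition nb_strength :: "(nat \<Rightarrow> int) \<Rightarrow> assembly \<Rightarrow> pos \<Rightarrow> tile \<Rightarrow> int" where
  "nb_strength str \<alpha> p t =
     (case \<alpha> (fst p, snd p + 1) of None \<Rightarrow> 0 | Some u \<Rightarrow> glue_int str (t North) (u South)) +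
     (case \<alpha> (fst p + 1, snd p) of None \<Rightarrow> 0 | Some u \<Rightarrow> glue_int str (t East) (u West)) +
     (case \<alpha> (fst p, snd p - 1) of None \<Rightarrow> 0 | Some u \<Rightarrow> glue_int str (t South) (u North)) +
     (case \<alpha> (fst p - 1, snd p) of None \<Rightarrow> 0 | Some u \<Rightarrow> glue_int str (t West) (u East))"

definition attachable :: "tile set \<Rightarrow> (nat \<Rightarrow> int) \<Rightarrow> int \<Rightarrow> assembly \<Rightarrow> pos \<Rightarrow> tile \<Rightarrow> bool" where
  "attachable T str \<tau> \<alpha> p t \<longleftrightarrow> \<alpha> p = None \<and> t \<in> T \<and> nb_strength str \<alpha> p t \<ge> \<tau>"

text \<open>An assembly sequence (possibly infinite; stuttering steps allow finite
sequences) starting from the seed; each step adds at most one tile.\<close>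
definition assembly_seq :: "tile set \<Rightarrow> (nat \<Rightarrow> int) \<Rightarrow> int \<Rightarrow> assembly \<Rightarrow> (nat \<Rightarrow> assembly) \<Rightarrow> bool" where
  "assembly_seq T str \<tau> \<sigma> f \<longleftrightarrow> f 0 = \<sigma> \<and>
     (\<forall>i. f (Suc i) = f i \<or> (\<exists>p t. attachable T str \<tau> (f i) p t \<and> f (Suc i) = (f i)(p \<mapsto> t)))"

definition producible :: "tile set \<Rightarrow> (nat \<Rightarrow> int) \<Rightarrow> int \<Rightarrow> assembly \<Rightarrow> assembly \<Rightarrow> bool" where
  "producible T str \<tau> \<sigma> \<alpha> \<longleftrightarrow> (\<exists>f. assembly_seq T str \<tau> \<sigma> f \<and>
     (\<forall>i. f i \<subseteq>\<^sub>m \<alpha>) \<and> dom \<alpha> = (\<Union>i. dom (f i)))"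

definition terminal :: "tile set \<Rightarrow> (nat \<Rightarrow> int) \<Rightarrow> int \<Rightarrow> assembly \<Rightarrow> bool" where
  "terminal T str \<tau> \<alpha> \<longleftrightarrow> (\<forall>p t. \<not> attachable T str \<tau> \<alpha> p t)"

definition terminal_assembly :: "tile set \<Rightarrow> (nat \<Rightarrow> int) \<Rightarrow> int \<Rightarrow> assembly \<Rightarrow> assembly \<Rightarrow> bool" where
  "terminal_assembly T str \<tau> \<sigma> \<alpha> \<longleftrightarrow> producible T str \<tau> \<sigma> \<alpha> \<and> terminal T str \<tau> \<alpha>"

definition directed :: "tile set \<Rightarrow> (nat \<Rightarrow> int) \<Rightarrow> int \<Rightarrow> assembly \<Rightarrow> bool" where
  "directed T str \<tau> \<sigma> \<longleftrightarrow> (\<exists>!\<alpha>. terminal_assembly T str \<tau> \<sigma> \<alpha>)"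

definition strictly_self_assembles :: "tile set \<Rightarrow> (nat \<Rightarrow> int) \<Rightarrow> int \<Rightarrow> assembly \<Rightarrow> pos set \<Rightarrow> bool" where
  "strictly_self_assembles T str \<tau> \<sigma> X \<longleftrightarrow>
     (\<forall>\<alpha>. terminal_assembly T str \<tau> \<sigma> \<alpha> \<longrightarrow> dom \<alpha> = X)"

definition glues_of :: "tile set \<Rightarrow> nat set" where
  "glues_of T = {t d | t d. t \<in> T}"

text \<open>Strength function of a prgTAS: the unique negative glue label neg gets
strength -m; every other label has strength 0 or 1 (given by w).\<close>
definition prg_str :: "(nat \<Rightarrow> int) \<Rightarrow> nat \<Rightarrow> nat \<Rightarrow> nat \<Rightarrow> int" where
  "prg_str w neg m g = (if g = neg then - int m else w g)"

definition square :: "nat \<Rightarrow> pos set" where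
  "square N = {(x, y). 0 \<le> x \<and> x < int N \<and> 0 \<le> y \<and> y < int N}"

end

theory Submission
  imports Defs "HOL-Library.Countable"
begin

text \<open>At temperature 1 cooperation is simulated by blocking. A bit is written by two tiles bordering
a one-cell pocket: the tile below the pocket or the tile beside it shows the negative glue, according
to the bit. A path entering the pocket has two candidate tiles, one for each value of the bit; the
tile for the wrong value carries the negative glue on a side that faces the negative glue of a
writer, so its total strength is \<open>1 - m \<le> 0\<close>, whereas the right one meets no negative glue at all.
The outcome therefore does not depend on \<open>m\<close>.

With such pockets a single path builds a binary counter of \<open>k\<close> bits in a strip of width
\<open>W = 4 k + 3\<close> and length \<open>H + 4 M\<close>: rightward passes increment the value, leftward passes copy it,
and the overflow after \<open>M\<close> increments ends the strip. Every pass sweeps the columns one by one, even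
columns upwards and odd columns downwards, and the path leaves every column at the level where it
enters the next one. Four rotated copies of the strip, arranged as a pinwheel and traversed one
after the other, surround a square of side \<open>N - 2 W\<close>, which is filled by a column and rows once it
is enclosed. Tile types are indexed by column, so there are \<open>O(k)\<close> of them.\<close>

section \<open>Tree-structured assemblies\<close>

text \<open>Tile types know the class of a pass but not its number, so each glue recurs throughout
  the strip; how far the counter has got is visible only in which writers of the previous pass show
  the negative glue. Glue labels therefore do not identify cells, and arguments about parents and
  children finish by comparing positions. Columns 1 to \<open>4 * k\<close> hold the bits, four
  columns per bit: a rightward pocket, a leftward pocket, a side wall shared by both and an entry
  column. Columns 0 and \<open>4 * k + 2\<close> are where the path turns; column
  \<open>4 * k + 1\<close> takes it down from the right turn to the level of the first leftward
  pocket. A rightward pass and the following pass together raise the strip by 4 rows, so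
  \<open>M\<close> fixes the length up to a residue modulo 4, which \<open>H\<close> absorbs. The
  interior must be filled by a bounded number of tile types, which cannot count. Its column and rows
  stop only where they run into a wall, so the walls have to be there before the filling starts;
  this is why the copies are built one after the other and only the last one opens the
  interior.\<close>

fun opp :: "side \<Rightarrow> side" where
  "opp North = South" | "opp South = North" | "opp East = West" | "opp West = East"

fun nb :: "pos \<Rightarrow> side \<Rightarrow> pos" where
  "nb p North = (fst p, snd p + 1)"
| "nb p East = (fst p + 1, snd p)"
| "nb p South = (fst p, snd p - 1)"
| "nb p West = (fst p - 1, snd p)"

lemma opp_opp [simp]: "opp (opp d) = d"
  by (cases d) auto

lemma opp_neq [simp]: "opp d \<noteq> d" "d \<noteq> opp d"
  by (cases d; simp)+

lemma nb_nb_opp [simp]: "nb (nb p d) (opp d) = p" "nb (nb p (opp d)) d = p"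
  by (cases d; simp)+

lemma nb_inj: "nb p d = nb q d \<longleftrightarrow> p = q"
  by (metis nb_nb_opp(1))

lemma UNIV_side: "(UNIV :: side set) = {North, East, South, West}"
  using side.exhaust by auto

instance side :: finite
  by standard (simp add: UNIV_side)

definition bond :: "(nat \<Rightarrow> int) \<Rightarrow> assembly \<Rightarrow> pos \<Rightarrow> tile \<Rightarrow> side \<Rightarrow> int" where
  "bond str \<alpha> p t d = (case \<alpha> (nb p d) of None \<Rightarrow> 0 | Some u \<Rightarrow> glue_int str (t d) (u (opp d)))"

lemma nb_strength_sum: "nb_strength str \<alpha> p t = (\<Sum>d\<in>UNIV. bond str \<alpha> p t d)"
  by (simp add: nb_strength_def bond_def UNIV_side cong: option.case_cong)

text \<open>The tiles of the intended assembly form a tree in which positive glue joins a tile only to its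
parent and its children. Producible assemblies are then exactly the parent-closed sets of nodes
(those reached so far), provided that every wrong candidate for a node is blocked by an ancestor.\<close>

locale tree_tas =
  fixes I :: "'n set" and pos :: "'n \<Rightarrow> pos" and A :: "'n \<Rightarrow> tile" and par :: "'n \<Rightarrow> 'n"
    and ins :: "'n \<Rightarrow> side" and s :: 'n and w :: "nat \<Rightarrow> int" and neg :: nat
  assumes fin: "finite I" and s_in: "s \<in> I" and inj: "inj_on pos I"
    and w01: "w g \<in> {0, 1}"
    and par_in: "p \<in> I \<Longrightarrow> p \<noteq> s \<Longrightarrow> par p \<in> I"
    and par_pos: "p \<in> I \<Longrightarrow> p \<noteq> s \<Longrightarrow> pos (par p) = nb (pos p) (ins p)"
    and wf_par: "wf {(par p, p) | p. p \<in> I - {s}}"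
    and edge_label: "p \<in> I \<Longrightarrow> p \<noteq> s \<Longrightarrow>
      A (par p) (opp (ins p)) = A p (ins p) \<and> A p (ins p) \<noteq> neg \<and> w (A p (ins p)) = 1"
    and pos_face: "q \<in> I \<Longrightarrow> A q d \<noteq> neg \<Longrightarrow> w (A q d) = 1 \<Longrightarrow>
      (\<exists>r\<in>I. (r, q) \<in> {(par p, p) | p. p \<in> I - {s}}\<^sup>* \<and> pos r = nb (pos q) d) \<or>
      (\<exists>p\<in>I - {s}. par p = q \<and> d = opp (ins p))"
    and no_conflict: "p \<in> I \<Longrightarrow> q \<in> I \<Longrightarrow> pos q = nb (pos p) d \<Longrightarrow> A p d = neg \<Longrightarrow> A q (opp d) \<noteq> neg"
    and block: "p \<in> I \<Longrightarrow> p \<noteq> s \<Longrightarrow> q \<in> I \<Longrightarrow> A q (ins p) = A p (ins p) \<Longrightarrow> A q \<noteq> A p \<Longrightarrow>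
      \<exists>d r. r \<in> I \<and> (r, par p) \<in> {(par p, p) | p. p \<in> I - {s}}\<^sup>* \<and> pos r = nb (pos p) d \<and>
            A q d = neg \<and> A r (opp d) = neg"
begin

abbreviation "Pr \<equiv> {(par p, p) | p. p \<in> I - {s}}"

definition closed_set :: "'n set \<Rightarrow> bool" where
  "closed_set D \<longleftrightarrow> s \<in> D \<and> D \<subseteq> I \<and> (\<forall>p\<in>D. p \<noteq> s \<longrightarrow> par p \<in> D)"

definition asm :: "'n set \<Rightarrow> assembly" where
  "asm D x = (if x \<in> pos ` D then Some (A (inv_into I pos x)) else None)"

lemma asm_pos: "D \<subseteq> I \<Longrightarrow> p \<in> D \<Longrightarrow> asm D (pos p) = Some (A p)"
  using inj by (auto simp: asm_def subset_iff)

lemma asm_SomeD: "D \<subseteq> I \<Longrightarrow> asm D x = Some t \<Longrightarrow> \<exists>p\<in>D. x = pos p \<and> t = A p"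
  using inj by (auto simp: asm_def subset_iff split: if_splits)

lemma asm_None: "D \<subseteq> I \<Longrightarrow> p \<in> I \<Longrightarrow> asm D (pos p) = None \<longleftrightarrow> p \<notin> D"
  using inj by (auto simp: asm_def inj_on_def subset_iff)

lemma dom_asm: "dom (asm D) = pos ` D"
  by (auto simp: asm_def split: if_splits)

lemma asm_insert: "D \<subseteq> I \<Longrightarrow> p \<in> I \<Longrightarrow> (asm D)(pos p \<mapsto> A p) = asm (insert p D)"
  using inj by (auto simp: asm_def fun_eq_iff)

lemma closed_anc: "closed_set D \<Longrightarrow> q \<in> D \<Longrightarrow> (r, q) \<in> Pr\<^sup>* \<Longrightarrow> r \<in> D"
  by (rotate_tac 2, induction rule: converse_rtrancl_induct) (auto simp: closed_set_def)

text \<open>A positive face of a placed tile points to a cell that is already filled or to a child,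
  so an empty cell with a positive bond is the cell of an unplaced child and the bond is on its side
  \<open>ins\<close>. Since \<open>pos\<close> is injective, only one side can be positive; a wrong
  tile thus gains at most 1 and loses \<open>m\<close> to its blocker.\<close>

lemma attach_unique:
  assumes D: "closed_set D" and m: "m \<ge> 1"
    and att: "attachable (A ` I) (prg_str w neg m) 1 (asm D) x t"
  shows "\<exists>p\<in>I - D. p \<noteq> s \<and> par p \<in> D \<and> x = pos p \<and> t = A p"
proof -
  let ?b = "bond (prg_str w neg m) (asm D) x t"
  have DI: "D \<subseteq> I" and sD: "s \<in> D" using D by (auto simp: closed_set_def)
  have x: "asm D x = None" and tI: "t \<in> A ` I"
    and st: "nb_strength (prg_str w neg m) (asm D) x t \<ge> 1"
    using att by (auto simp: attachable_def)
  have bpos: "\<exists>p\<in>I - D. p \<noteq> s \<and> par p \<in> D \<and> x = pos p \<and> d = ins p \<and> t d = A p (ins p) \<and> ?b d = 1"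
    if "?b d > 0" for d
  proof -
    obtain u where u: "asm D (nb x d) = Some u" and g: "glue_int (prg_str w neg m) (t d) (u (opp d)) > 0"
      using \<open>?b d > 0\<close> by (auto simp: bond_def split: option.splits)
    obtain q where q: "q \<in> D" "nb x d = pos q" "u = A q"
      using asm_SomeD[OF DI u] by blast
    have l: "t d = A q (opp d)" "A q (opp d) \<noteq> neg" "w (A q (opp d)) = 1" "?b d = 1"
      using g w01[of "A q (opp d)"] u m q by (auto simp: glue_int_def prg_str_def bond_def split: if_splits)
    \<comment> \<open>Ancestors of a placed node are placed, so such an \<open>r\<close> would
      occupy the empty cell \<open>x\<close>.\<close>
    have "\<not> (\<exists>r\<in>I. (r, q) \<in> Pr\<^sup>* \<and> pos r = nb (pos q) (opp d))"
    proof
      assume "\<exists>r\<in>I. (r, q) \<in> Pr\<^sup>* \<and> pos r = nb (pos q) (opp d)"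
      then obtain r where r: "(r, q) \<in> Pr\<^sup>*" "pos r = nb (pos q) (opp d)" by blast
      have "r \<in> D" by (rule closed_anc[OF D q(1) r(1)])
      moreover have "pos r = x" using r(2) q(2) by (metis nb_nb_opp(1))
      ultimately have "r \<in> D" "pos r = x" by auto
      then show False using x asm_pos[OF DI] by auto
    qed
    then obtain p where p: "p \<in> I - {s}" "par p = q" "opp d = opp (ins p)"
      using pos_face[of q "opp d"] q(1) DI l by auto
    have dp: "d = ins p" using p(3) by (metis opp_opp)
    have "nb x d = nb (pos p) d" using par_pos[of p] p q(2) dp by auto
    then have xp: "x = pos p" by (simp add: nb_inj)
    then have "p \<notin> D" using x asm_None[OF DI] p by auto
    then show ?thesis using p q(1) xp dp l edge_label[of p] by auto
  qed
  have "\<exists>d. ?b d > 0"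
  proof (rule ccontr)
    assume "\<not> ?thesis"
    then have "(\<Sum>d\<in>UNIV. ?b d) \<le> 0" by (intro sum_nonpos) (auto simp: not_less)
    then show False using st by (simp add: nb_strength_sum)
  qed
  then obtain d p where p: "p \<in> I - D" "p \<noteq> s" "par p \<in> D" "x = pos p" "d = ins p" "t d = A p (ins p)" "?b d = 1"
    using bpos by metis
  have "t = A p"
  proof (rule ccontr)
    assume "t \<noteq> A p"
    obtain q where q: "q \<in> I" "t = A q" using tI by auto
    obtain e r where r: "r \<in> I" "(r, par p) \<in> Pr\<^sup>*" "pos r = nb (pos p) e" "t e = neg" "A r (opp e) = neg"
      using block[of p q] p q \<open>t \<noteq> A p\<close> by auto
    have rD: "r \<in> D" using closed_anc[OF D p(3) r(2)] .
    have be: "?b e = - int m"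
      using asm_pos[OF DI rD] r p(4) by (auto simp: bond_def glue_int_def prg_str_def)
    have only: "?b e' \<le> 0" if "e' \<noteq> d" for e'
    proof (rule ccontr)
      assume "\<not> ?b e' \<le> 0"
      then obtain p' where "p' \<in> I" "x = pos p'" "e' = ins p'" using bpos[of e'] by auto
      then show False using inj p that by (auto simp: inj_on_def)
    qed
    have ed: "e \<noteq> d" using be p m by auto
    have "(\<Sum>d\<in>UNIV. ?b d) = ?b d + (?b e + (\<Sum>x\<in>UNIV - {d} - {e}. ?b x))"
      using ed by (simp add: sum.remove[of UNIV d] sum.remove[of "UNIV - {d}" e])
    \<comment> \<open>One bond of strength 1, the blocker's \<open>- m\<close>, and two sides that
      are not positive by \<open>only\<close>.\<close>
    also have "\<dots> \<le> 1 + (- int m + 0)"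
      using p be only by (intro add_mono sum_nonpos) auto
    finally show False using st m by (simp add: nb_strength_sum)
  qed
  then show ?thesis using p by auto
qed

text \<open>By \<open>no_conflict\<close> no correct tile is ever repelled, whichever of its
  neighbours are present. So the order of growth cannot stall a node whose parent is placed.\<close>

lemma attach_next:
  assumes D: "closed_set D" and p: "p \<in> I" "p \<notin> D" "par p \<in> D"
  shows "attachable (A ` I) (prg_str w neg m) 1 (asm D) (pos p) (A p)"
proof -
  let ?b = "bond (prg_str w neg m) (asm D) (pos p) (A p)"
  have DI: "D \<subseteq> I" and ps: "p \<noteq> s" using D p by (auto simp: closed_set_def)
  have b0: "?b d \<ge> 0" for d
  proof (cases "asm D (nb (pos p) d)")
    case (Some u)
    then obtain q where q: "q \<in> D" "nb (pos p) d = pos q" "u = A q" using asm_SomeD[OF DI] by metis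
    then show ?thesis using no_conflict[of p q d] p(1) DI Some w01[of "A p d"]
      by (auto simp: bond_def glue_int_def prg_str_def)
  qed (simp add: bond_def)
  have "?b (ins p) = 1"
    using asm_pos[OF DI p(3)] par_pos[OF p(1) ps] edge_label[OF p(1) ps]
    by (auto simp: bond_def glue_int_def prg_str_def)
  then have "(\<Sum>d\<in>UNIV. ?b d) \<ge> 1"
    using member_le_sum[of "ins p" UNIV ?b] b0 by auto
  then show ?thesis
    using p asm_None[OF DI p(1)] by (simp add: attachable_def nb_strength_sum)
qed

lemma closed_insert: "closed_set D \<Longrightarrow> p \<in> I \<Longrightarrow> par p \<in> D \<Longrightarrow> closed_set (insert p D)"
  by (auto simp: closed_set_def)

text \<open>A missing node that is minimal for the parent relation has its parent present.\<close>

lemma closed_full: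
  assumes "closed_set D" "D \<noteq> I"
  shows "\<exists>p\<in>I - D. par p \<in> D"
proof -
  obtain z where z: "z \<in> I - D" using assms by (auto simp: closed_set_def)
  have "\<exists>p\<in>I - D. \<forall>y. (y, p) \<in> Pr \<longrightarrow> y \<notin> I - D"
    by (rule wfE_min[OF wf_par z]) blast
  then obtain p where p: "p \<in> I - D" "\<And>y. (y, p) \<in> Pr \<Longrightarrow> y \<notin> I - D" by blast
  have "p \<noteq> s" using p(1) assms by (auto simp: closed_set_def)
  then have "par p \<notin> I - D" using p by blast
  then show ?thesis using p(1) par_in[of p] \<open>p \<noteq> s\<close> by blast
qed

lemma seq_closed:
  assumes m: "m \<ge> 1"
    and f: "assembly_seq (A ` I) (prg_str w neg m) 1 [pos s \<mapsto> A s] f"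
  shows "\<exists>D. closed_set D \<and> f i = asm D"
proof (induction i)
  case 0
  have "f 0 = asm {s}" using f s_in inj by (auto simp: assembly_seq_def asm_def fun_eq_iff)
  then show ?case using s_in by (intro exI[of _ "{s}"]) (auto simp: closed_set_def)
next
  case (Suc i)
  then obtain D where D: "closed_set D" "f i = asm D" by auto
  consider "f (Suc i) = f i"
    | x t where "attachable (A ` I) (prg_str w neg m) 1 (f i) x t" "f (Suc i) = (f i)(x \<mapsto> t)"
    using f unfolding assembly_seq_def by blast
  then show ?case
  proof cases
    case 1
    then show ?thesis using D by auto
  next
    case 2
    then obtain p where p: "p \<in> I - D" "par p \<in> D" "x = pos p" "t = A p"
      using attach_unique[OF D(1) m] D(2) by metis
    have "D \<subseteq> I" using D(1) by (auto simp: closed_set_def)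
    then have "f (Suc i) = asm (insert p D)" using 2 p D(2) asm_insert by auto
    then show ?thesis using closed_insert[OF D(1)] p by blast
  qed
qed

text \<open>The limit of a possibly infinite sequence is the assembly of a union of closed sets,
  which is closed. If it were not all of \<open>I\<close>, \<open>closed_full\<close> and
  \<open>attach_next\<close> would extend it.\<close>

lemma terminal_full:
  assumes m: "m \<ge> 1"
    and t: "terminal_assembly (A ` I) (prg_str w neg m) 1 [pos s \<mapsto> A s] \<alpha>"
  shows "\<alpha> = asm I"
proof -
  obtain f where f: "assembly_seq (A ` I) (prg_str w neg m) 1 [pos s \<mapsto> A s] f"
    and sub: "\<And>i. f i \<subseteq>\<^sub>m \<alpha>" and dom: "dom \<alpha> = (\<Union>i. dom (f i))"
    using t by (auto simp: terminal_assembly_def producible_def)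
  obtain D where D: "\<And>i. closed_set (D i)" "\<And>i. f i = asm (D i)"
    using seq_closed[OF m f] by metis
  define E where "E = (\<Union>i. D i)"
  have E: "closed_set E" using D(1) by (auto simp: E_def closed_set_def)
  have EI: "E \<subseteq> I" using E by (auto simp: closed_set_def)
  have "\<alpha> = asm E"
  proof
    fix x
    show "\<alpha> x = asm E x"
    proof (cases "x \<in> dom \<alpha>")
      case True
      then obtain i where i: "x \<in> dom (f i)" using dom by auto
      then have "\<alpha> x = f i x" using sub[of i] by (auto simp: map_le_def)
      moreover have "asm E x = f i x" using i D(2)[of i] dom_asm[of "D i"] by (auto simp: asm_def E_def)
      ultimately show ?thesis by simp
    next
      case False
      then have "x \<notin> pos ` E" using dom D(2) by (auto simp: dom_asm E_def)
      then show ?thesis using False by (auto simp: asm_def domIff)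
    qed
  qed
  moreover have "E = I"
  proof (rule ccontr)
    assume "E \<noteq> I"
    then obtain p where "p \<in> I" "p \<notin> E" "par p \<in> E" using closed_full[OF E] by auto
    then have "attachable (A ` I) (prg_str w neg m) 1 \<alpha> (pos p) (A p)"
      using attach_next[OF E] \<open>\<alpha> = asm E\<close> by blast
    then show False using t unfolding terminal_assembly_def terminal_def by blast
  qed
  ultimately show ?thesis by simp
qed

lemma full_terminal:
  assumes m: "m \<ge> 1"
  shows "terminal_assembly (A ` I) (prg_str w neg m) 1 [pos s \<mapsto> A s] (asm I)"
proof -
  let ?seq = "assembly_seq (A ` I) (prg_str w neg m) 1 [pos s \<mapsto> A s]"
  have cI: "closed_set I" using s_in par_in by (auto simp: closed_set_def)
  \<comment> \<open>The sequences are eventually constant, so their last assembly is also their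
    limit.\<close>
  have step: "\<exists>f j D. ?seq f \<and> (\<forall>i\<ge>j. f i = asm D) \<and> closed_set D \<and> (\<forall>i. f i \<subseteq>\<^sub>m asm D) \<and>
      (D = I \<or> card D \<ge> n)" for n
  proof (induction n)
    case 0
    have "?seq (\<lambda>i. asm {s}) "
      using s_in inj by (auto simp: assembly_seq_def asm_def fun_eq_iff)
    then show ?case using s_in
      by (intro exI[of _ "\<lambda>i. asm {s}"] exI[of _ 0] exI[of _ "{s}"])
        (simp add: closed_set_def del: fun_upd_apply)
  next
    case (Suc n)
    then obtain f j D where f: "?seq f" "\<And>i. i \<ge> j \<Longrightarrow> f i = asm D" "closed_set D" "\<And>i. f i \<subseteq>\<^sub>m asm D"
      "D = I \<or> card D \<ge> n" by blast
    show ?case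
    proof (cases "D = I")
      case True
      then show ?thesis using f by blast
    next
      case False
      then obtain p where p: "p \<in> I" "p \<notin> D" "par p \<in> D" using closed_full[OF f(3)] by auto
      have DI: "D \<subseteq> I" using f by (auto simp: closed_set_def)
      let ?D = "insert p D" and ?f = "\<lambda>i. if i \<le> j then f i else asm (insert p D)"
      have at: "attachable (A ` I) (prg_str w neg m) 1 (f j) (pos p) (A p)"
        using attach_next[OF f(3) p] f(2)[of j] by auto
      have e: "asm ?D = (f j)(pos p \<mapsto> A p)" using asm_insert[OF DI p(1)] f(2)[of j] by auto
      have a1: "?seq ?f"
        unfolding assembly_seq_def
      proof (intro conjI allI)
        show "?f 0 = [pos s \<mapsto> A s]" using f(1) by (auto simp: assembly_seq_def)
        fix i
        show "?f (Suc i) = ?f i \<or> (\<exists>q t. attachable (A ` I) (prg_str w neg m) 1 (?f i) q t \<and> ?f (Suc i) = (?f i)(q \<mapsto> t))"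
        proof -
          consider "Suc i \<le> j" | "i = j" | "i > j" by linarith
          then show ?thesis
          proof cases
            case 1
            then show ?thesis using f(1) by (auto simp: assembly_seq_def)
          next
            case 2
            have "attachable (A ` I) (prg_str w neg m) 1 (?f i) (pos p) (A p)" using at 2 by simp
            moreover have "?f (Suc i) = (?f i)(pos p \<mapsto> A p)" using e 2 by simp
            ultimately show ?thesis by blast
          qed auto
        qed
      qed
      have "asm D \<subseteq>\<^sub>m asm ?D" by (auto simp: map_le_def asm_def split: if_splits)
      then have a2: "\<forall>i. ?f i \<subseteq>\<^sub>m asm ?D" using f(4) map_le_trans by auto
      have a3: "?D = I \<or> card ?D \<ge> Suc n" using f(5) False p DI fin by (auto simp: finite_subset)
      have a4: "\<forall>i\<ge>Suc j. ?f i = asm ?D" by simp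
      have a5: "closed_set ?D" using closed_insert[OF f(3)] p by auto
      show ?thesis
        by (rule exI[of _ ?f], rule exI[of _ "Suc j"], rule exI[of _ ?D], intro conjI a1 a2 a3 a4 a5)
    qed
  qed
  \<comment> \<open>No subset of \<open>I\<close> has \<open>Suc (card I)\<close> elements, which
    leaves only \<open>D = I\<close>.\<close>
  obtain f j D where f: "?seq f" "\<And>i. i \<ge> j \<Longrightarrow> f i = asm D" "closed_set D" "\<And>i. f i \<subseteq>\<^sub>m asm D"
    "D = I \<or> card D \<ge> Suc (card I)" using step[of "Suc (card I)"] by blast
  have DI: "D = I" using f(3,5) card_mono[OF fin, of D] by (auto simp: closed_set_def)
  have "dom (asm D) = (\<Union>i. dom (f i))"
  proof
    show "dom (asm D) \<subseteq> (\<Union>i. dom (f i))"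
      using f(2)[of j] by (intro SUP_upper2[of j]) simp_all
    show "(\<Union>i. dom (f i)) \<subseteq> dom (asm D)"
      by (intro UN_least map_le_implies_dom_le f(4))
  qed
  then have "producible (A ` I) (prg_str w neg m) 1 [pos s \<mapsto> A s] (asm I)"
    using f DI by (auto simp: producible_def)
  moreover have "terminal (A ` I) (prg_str w neg m) 1 (asm I)"
    using attach_unique[OF cI m] by (auto simp: terminal_def)
  ultimately show ?thesis by (simp add: terminal_assembly_def)
qed

theorem tree_directed:
  assumes "m \<ge> 1"
  shows "directed (A ` I) (prg_str w neg m) 1 [pos s \<mapsto> A s]"
    and "strictly_self_assembles (A ` I) (prg_str w neg m) 1 [pos s \<mapsto> A s] (pos ` I)"
  using full_terminal[OF assms] terminal_full[OF assms] dom_asm[of I]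
  unfolding directed_def strictly_self_assembles_def by metis+

end

section \<open>The counter strip\<close>

fun rotc :: "side \<Rightarrow> side" where
  "rotc North = East" | "rotc East = South" | "rotc South = West" | "rotc West = North"

fun rot :: "nat \<Rightarrow> side \<Rightarrow> side" where
  "rot 0 d = d" | "rot (Suc i) d = rotc (rot i d)"

fun unrot :: "nat \<Rightarrow> side \<Rightarrow> side" where
  "unrot 0 d = d" | "unrot (Suc i) d = unrot i (rotc (rotc (rotc d)))"

lemma rotc4 [simp]: "rotc (rotc (rotc (rotc d))) = d"
  by (cases d) auto

lemma unrot_rot [simp]: "unrot i (rot i d) = d"
  by (induction i) auto

lemma rot_unrot [simp]: "rot i (unrot i d) = d"
  by (induction i arbitrary: d) auto

lemma rot_opp: "rot i (opp d) = opp (rot i d)"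
proof (induction i)
  case (Suc i)
  have "rotc (opp e) = opp (rotc e)" for e by (cases e) auto
  with Suc show ?case by simp
qed simp

lemma unrot_opp: "unrot i (opp d) = opp (unrot i d)"
  by (metis rot_opp rot_unrot unrot_rot)

section \<open>Binary increment\<close>

definition bit_at :: "nat \<Rightarrow> nat \<Rightarrow> bool" where
  "bit_at v j \<longleftrightarrow> odd (v div 2 ^ j)"

text \<open>A carry enters position \<open>j\<close> iff the lower \<open>j\<close> bits of
  \<open>v\<close> are all 1, that is, iff \<open>2 ^ j\<close> divides \<open>Suc v\<close>.
  Writing carries as divisibility of the new value gives them a closed form.\<close>

lemma bit_at_Suc: "bit_at (Suc v) j \<longleftrightarrow> (bit_at v j \<noteq> (2 ^ j dvd Suc v))"
  by (cases "2 ^ j dvd Suc v") (auto simp: bit_at_def div_Suc mod_eq_0_iff_dvd)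

text \<open>The carry out of position \<open>j\<close> is the conjunction of the old bit and the
  carry into it.\<close>

lemma dvd_Suc_bit_at: "2 ^ Suc j dvd Suc v \<longleftrightarrow> bit_at v j \<and> 2 ^ j dvd Suc v"
proof (cases "2 ^ j dvd Suc v")
  case True
  then obtain c where c: "Suc v = 2 ^ j * c" by blast
  have "2 ^ Suc j dvd Suc v \<longleftrightarrow> even c" by (simp add: c mult.commute)
  moreover have "Suc v div 2 ^ j = c" by (simp add: c)
  ultimately show ?thesis using True bit_at_Suc[of v j] unfolding bit_at_def by blast
next
  case False
  then show ?thesis by (metis dvd_mult_left dvd_mult_right power_Suc)
qed

type_synonym label = "nat \<times> nat \<times> nat \<times> nat \<times> bool \<times> bool"

text \<open>Glue 0 has strength 0, glue 1 is the negative one, and all other glues have strength 1.\<close>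

definition enc :: "label \<Rightarrow> nat" where
  "enc l = Suc (Suc (to_nat l))"

lemma enc_eq [simp]: "enc l = enc l' \<longleftrightarrow> l = l'"
  by (simp add: enc_def)

lemma enc_neq [simp]: "enc l \<noteq> 0" "enc l \<noteq> Suc 0" "0 \<noteq> enc l" "Suc 0 \<noteq> enc l"
  by (simp_all add: enc_def)

definition wt :: "nat \<Rightarrow> int" where
  "wt g = (if g = 0 then 0 else 1)"

text \<open>\<open>Strip \<rho> \<pi> u e\<close> is the cell of the \<open>\<rho>\<close>-th copy of the strip visited during pass \<open>\<pi>\<close> in column
\<open>u\<close>, at height \<open>e\<close> above the base line of that pass. Pass 0 is the hard-coded initial one, odd passes
run right, even passes run left, and pass \<open>2 M\<close> flattens the top. \<open>Fill x y\<close> is an inner cell of the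
square.\<close>

datatype node = Strip nat nat nat nat | Fill nat nat

text \<open>\<open>N_eq\<close> makes width plus length of a strip equal to the side of the square,
  so that each copy ends exactly where the next one begins; \<open>N_big\<close> keeps the interior
  nonempty, and \<open>M2\<close> makes the start value \<open>2 ^ k - M\<close> meaningful.\<close>

locale counter =
  fixes k M H N :: nat
  assumes k1: "k \<ge> 1" and M1: "M \<ge> 1" and M2: "M \<le> 2 ^ k" and H1: "H \<ge> 1"
    and N_eq: "N = 4 * k + 3 + (H + 4 * M)" and N_big: "2 * (4 * k + 3) < N"
begin

definition W :: nat where "W = 4 * k + 3"

text \<open>The heights of the columns, relative to the base line, before a rightward and before a leftward
pass. These are the profiles for which consecutive columns of a pass share the level of the crossing,
and in which the pockets and their side walls occur.\<close>

definition zig_floor :: "nat \<Rightarrow> nat" where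
  "zig_floor u = (if u = 0 then 3 else if u > 4 * k then 1
           else if u mod 4 = 0 \<or> u mod 4 = 3 then 1 else 0)"

definition zag_floor :: "nat \<Rightarrow> nat" where
  "zag_floor u = (if u \<le> 1 then 3 else if u = 4 * k + 2 then 5
           else if u mod 4 \<le> 1 then 2 else 3)"

text \<open>The classes 0, 1, 2, 3 stand for the initial, rightward, leftward and final pass. Column
\<open>4 k + 2\<close> is shorter when the carry leaving the counter signals overflow.\<close>

definition cls_lo :: "nat \<Rightarrow> nat \<Rightarrow> nat" where
  "cls_lo c u = (if c = 0 then 0 else if c = 1 then zig_floor u else if c = 2 then zag_floor u else min 4 (zag_floor u))"

definition cls_hi :: "nat \<Rightarrow> nat \<Rightarrow> bool \<Rightarrow> nat" where
  "cls_hi c u cy = (if c = 0 then H + zig_floor u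
     else if c = 1 then (if u = 4 * k + 2 \<and> cy then 4 else zag_floor u)
     else if c = 2 then 4 + zig_floor u else 4)"

definition cls :: "nat \<Rightarrow> nat" where
  "cls \<pi> = (if \<pi> = 0 then 0 else if \<pi> = 2 * M then 3 else if odd \<pi> then 1 else 2)"

text \<open>Passes \<open>2 n + 1\<close> and \<open>2 n + 2\<close> share a base line; only the
  change to the next rightward pass raises it, by 4.\<close>

definition base :: "nat \<Rightarrow> nat" where
  "base \<pi> = (if \<pi> = 0 then 0 else H + 4 * ((\<pi> - 1) div 2))"

text \<open>The offset makes increment number \<open>M\<close> the first one to reach
  \<open>2 ^ k\<close>.\<close>

definition val :: "nat \<Rightarrow> nat" where
  "val i = 2 ^ k - M + i"

text \<open>The information carried by the path: the bit last computed and the carry.\<close>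

definition info :: "nat \<Rightarrow> nat \<Rightarrow> bool \<times> bool" where
  "info \<pi> u = (if \<pi> = 0 then (False, False)
     else if odd \<pi> then
       (if u \<le> 1 then (False, True)
        else (bit_at (val (Suc (\<pi> div 2))) (min (k - 1) ((u - 2) div 4)),
              2 ^ Suc (min (k - 1) ((u - 2) div 4)) dvd val (Suc (\<pi> div 2))))
     else if \<pi> = 2 * M then (False, True)
     else (bit_at (val (\<pi> div 2)) (min (k - 1) ((u - 1) div 4)), False))"

definition lo :: "nat \<Rightarrow> nat \<Rightarrow> nat" where "lo \<pi> u = cls_lo (cls \<pi>) u"
definition hi :: "nat \<Rightarrow> nat \<Rightarrow> nat" where "hi \<pi> u = cls_hi (cls \<pi>) u (snd (info \<pi> u))"

text \<open>Bit \<open>j\<close> uses the rightward pocket in column \<open>4 j + 2\<close> and the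
  leftward one in column \<open>4 j + 4\<close>; column \<open>4 j + 3\<close> between them is the
  side wall of both.\<close>

definition pocket :: "nat \<Rightarrow> nat \<Rightarrow> nat \<Rightarrow> bool" where
  "pocket c u e \<longleftrightarrow> (c = 1 \<and> u mod 4 = 2 \<and> u < 4 * k + 2 \<and> e = 0) \<or>
                     (c = 2 \<and> u mod 4 = 0 \<and> 0 < u \<and> e = 2)"

text \<open>The input glue of a reader must carry the state before the bit is read, hence that of
  the column just left, in the direction of travel. Both candidates of a pocket share this
  glue.\<close>

definition ininfo :: "nat \<Rightarrow> nat \<Rightarrow> nat \<Rightarrow> bool \<times> bool" where
  "ininfo \<pi> u e = (if pocket (cls \<pi>) u e
     then (if odd \<pi> then info \<pi> (u - 1) else info \<pi> (u + 1)) else info \<pi> u)"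

definition read_bit :: "nat \<Rightarrow> nat \<Rightarrow> bool" where
  "read_bit \<pi> u = bit_at (val (\<pi> div 2)) ((u - 1) div 4)"

text \<open>A half adder. With carry 0 it merely copies the bit, so one rule serves both
  directions.\<close>

definition out_info :: "nat \<Rightarrow> nat \<Rightarrow> nat \<Rightarrow> bool \<times> bool \<Rightarrow> bool \<Rightarrow> bool \<times> bool" where
  "out_info c u e i r = (if pocket c u e then (r \<noteq> snd i, r \<and> snd i) else i)"

text \<open>Rightward passes skip column 0 and all leftward passes except the initial one skip
  column \<open>4 * k + 2\<close>. The direction of the sweep in a column is therefore the same in
  every pass and depends only on the parity of \<open>u\<close>.\<close>

definition in_side :: "nat \<Rightarrow> nat \<Rightarrow> nat \<Rightarrow> bool \<Rightarrow> side" where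
  "in_side c u e cy = (let h = (if c = 1 then West else East) in
     if even u then (if e = cls_lo c u then h else South)
     else (if Suc e = cls_hi c u cy then h else North))"

definition out_side :: "nat \<Rightarrow> nat \<Rightarrow> nat \<Rightarrow> bool \<Rightarrow> side" where
  "out_side c u e cy = (let h = (if c = 1 then (if u = 4 * k + 2 then West else East)
       else if u > 0 then West else if c = 3 then North else East) in
     if even u then (if Suc e = cls_hi c u cy then h else North)
     else (if e = cls_lo c u then h else South))"

text \<open>A glue names the copy, class, column and height of the child it leads to, and the information
handed over to it.\<close>

definition child_label :: "nat \<Rightarrow> nat \<Rightarrow> nat \<Rightarrow> nat \<Rightarrow> bool \<times> bool \<Rightarrow> label" where
  "child_label \<rho> c u e i = (let h = (if c = 1
         then (if u = 4 * k + 2 then (\<rho>, if snd i then 3 else 2, 4 * k + 1, e, i) else (\<rho>, 1, u + 1, e, i))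
       else if u > 0 then (\<rho>, c, u - 1, e, i)
       else if c = 3 then (Suc \<rho>, 0, 4 * k + 2, 0, False, False) else (\<rho>, 1, 1, 2, False, True)) in
     if even u then (if Suc e = cls_hi c u (snd i) then h else (\<rho>, c, u, Suc e, i))
     else (if e = cls_lo c u then h else (\<rho>, c, u, e - 1, i)))"

text \<open>First the two faces of a reader (below, and towards the side wall), then the faces of the writers
below a pocket, and finally those of the writers beside the pockets of the next leftward and
rightward pass.\<close>

definition neg_face :: "nat \<Rightarrow> nat \<Rightarrow> nat \<Rightarrow> bool \<times> bool \<Rightarrow> bool \<Rightarrow> side \<Rightarrow> bool" where
  "neg_face c u e i r d \<longleftrightarrow>
     (let b = (if c = 0 then bit_at (val 0) ((u - 1) div 4) else fst i) in
     pocket c u e \<and> (d = South \<and> r \<or> d = (if c = 1 then East else West) \<and> \<not> r) \<or>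
     (c = 1 \<and> u mod 4 = 0 \<or> c = 2 \<and> u mod 4 = 2 \<or> c = 0 \<and> u mod 4 = 2 \<and> u < 4 * k + 2 \<and> Suc e = H) \<and> d = North \<and> \<not> b \<or>
     c = 1 \<and> u mod 4 = 3 \<and> e = 2 \<and> d = East \<and> b \<or>
     u mod 4 = 3 \<and> (c = 2 \<and> e = 4 \<or> c = 0 \<and> e = H) \<and> d = West \<and> b)"

text \<open>Only the last copy opens the way to the interior, with label 4, and only in the top cell of its
inner boundary column. Labels 4 and 5 belong to the first column and to the rows of the interior.\<close>

definition path_tile :: "nat \<Rightarrow> nat \<Rightarrow> nat \<Rightarrow> nat \<Rightarrow> bool \<times> bool \<Rightarrow> bool \<Rightarrow> tile" where
  "path_tile \<rho> c u e i r d = (let i' = out_info c u e i r in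
     if d = in_side c u e (snd i') then
       (if \<rho> = 0 \<and> c = 0 \<and> u = 4 * k + 2 \<and> e = 0 then 0 else enc (\<rho>, c, u, e, i))
     else if d = out_side c u e (snd i') then
       (if \<rho> = 3 \<and> c = 3 \<and> u = 0 then 0 else enc (child_label \<rho> c u e i'))
     else if neg_face c u e i' r d then 1
     else if \<rho> = 3 \<and> c = 1 \<and> u = 4 * k + 2 \<and> e = 3 \<and> snd i' \<and> d = East then enc (4, 0, 0, 0, False, False)
     else 0)"

fun node_tile :: "node \<Rightarrow> tile" where
  "node_tile (Strip \<rho> \<pi> u e) = (\<lambda>d. path_tile \<rho> (cls \<pi>) u e (ininfo \<pi> u e) (read_bit \<pi> u) (unrot \<rho> d))"
| "node_tile (Fill x y) = (\<lambda>d. if x = W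
     then (if d = North \<or> d = South then enc (4, 0, 0, 0, False, False)
           else if d = East then enc (5, 0, 0, 0, False, False) else 0)
     else (if d = East \<or> d = West then enc (5, 0, 0, 0, False, False) else 0))"

text \<open>Clockwise quarter turns of the \<open>N\<close> by \<open>N\<close> square about its
  centre, matching \<open>rot\<close> on sides.\<close>

fun rotp :: "nat \<Rightarrow> pos \<Rightarrow> pos" where
  "rotp 0 p = p" | "rotp (Suc i) p = (snd (rotp i p), int N - 1 - fst (rotp i p))"

definition lpos :: "nat \<Rightarrow> nat \<Rightarrow> nat \<Rightarrow> pos" where
  "lpos \<pi> u e = (int u, int (base \<pi> + e))"

fun npos :: "node \<Rightarrow> pos" where
  "npos (Strip \<rho> \<pi> u e) = rotp \<rho> (lpos \<pi> u e)"
| "npos (Fill x y) = (int x, int y)"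

text \<open>The parent of the first cell of a column. The shifts by \<open>H\<close> and by 4 at
  \<open>u = 1\<close> translate between the base lines of consecutive passes; the right turn needs
  no shift, as both passes share their base line.\<close>

definition hpar :: "nat \<Rightarrow> nat \<Rightarrow> nat \<Rightarrow> nat \<Rightarrow> node" where
  "hpar \<rho> \<pi> u e = (if odd \<pi> then
       (if u = 1 then (if \<pi> = 1 then Strip \<rho> 0 0 (e + H) else Strip \<rho> (\<pi> - 1) 0 (e + 4))
        else Strip \<rho> \<pi> (u - 1) e)
     else if u = 4 * k + 2 then Strip (\<rho> - 1) (2 * M) 0 3
     else if u = 4 * k + 1 \<and> \<pi> > 0 then Strip \<rho> (\<pi> - 1) (4 * k + 2) e
     else Strip \<rho> \<pi> (u + 1) e)"

fun par :: "node \<Rightarrow> node" where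
  "par (Strip \<rho> \<pi> u e) =
     (if even u then (if lo \<pi> u < e then Strip \<rho> \<pi> u (e - 1) else hpar \<rho> \<pi> u e)
      else (if Suc e < hi \<pi> u then Strip \<rho> \<pi> u (Suc e) else hpar \<rho> \<pi> u e))"
| "par (Fill x y) = (if x > W then Fill (x - 1) y else if y > W then Fill x (y - 1)
     else Strip 3 (2 * M - 1) (4 * k + 2) 3)"

fun ins :: "node \<Rightarrow> side" where
  "ins (Strip \<rho> \<pi> u e) = rot \<rho> (in_side (cls \<pi>) u e (snd (info \<pi> u)))"
| "ins (Fill x y) = (if x > W then West else South)"

definition path_nodes :: "node set" where
  "path_nodes = {Strip \<rho> \<pi> u e | \<rho> \<pi> u e. \<rho> < 4 \<and> \<pi> \<le> 2 * M \<and> u < W \<and> lo \<pi> u \<le> e \<and> e < hi \<pi> u}"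

definition fill_nodes :: "node set" where
  "fill_nodes = {Fill x y | x y. W \<le> x \<and> x < N - W \<and> W \<le> y \<and> y < N - W}"

definition I :: "node set" where "I = path_nodes \<union> fill_nodes"

definition seed :: node where "seed = Strip 0 0 (4 * k + 2) 0"

lemma path_nodes_iff: "Strip \<rho> \<pi> u e \<in> path_nodes \<longleftrightarrow> \<rho> < 4 \<and> \<pi> \<le> 2 * M \<and> u \<le> 4 * k + 2 \<and> lo \<pi> u \<le> e \<and> e < hi \<pi> u"
  by (auto simp: path_nodes_def W_def)

lemma I_Strip: "Strip \<rho> \<pi> u e \<in> I \<longleftrightarrow> Strip \<rho> \<pi> u e \<in> path_nodes"
  by (auto simp: I_def fill_nodes_def)

lemma I_Fill: "Fill x y \<in> I \<longleftrightarrow> W \<le> x \<and> x < N - W \<and> W \<le> y \<and> y < N - W"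
  by (auto simp: I_def fill_nodes_def path_nodes_def)

lemma rotp_nb: "rotp i (nb p d) = nb (rotp i p) (rot i d)"
proof (induction i)
  case (Suc i)
  have "(snd (nb q e), int N - 1 - fst (nb q e)) = nb (snd q, int N - 1 - fst q) (rotc e)" for q e
    by (cases e) auto
  with Suc show ?case by simp
qed simp

lemma cls_simps: "cls 0 = 0" "cls (2 * M) = 3" "odd \<pi> \<Longrightarrow> cls \<pi> = 1"
  "even \<pi> \<Longrightarrow> 0 < \<pi> \<Longrightarrow> \<pi> \<noteq> 2 * M \<Longrightarrow> cls \<pi> = 2"
  using M1 by (auto simp: cls_def odd_pos)

lemma val_M: "val M = 2 ^ k"
  using M2 by (simp add: val_def)

text \<open>Column \<open>4 * k + 2\<close> carries the carry out of bit \<open>k - 1\<close>, which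
  is set iff \<open>2 ^ k\<close> divides the new value. Values stay positive and below
  \<open>2 ^ k\<close> until the last increment yields exactly \<open>2 ^ k\<close>, whose bit
  \<open>k - 1\<close> is 0; this is the constant information of the final pass.\<close>

lemma info_turn:
  assumes "odd \<pi>" "\<pi> < 2 * M"
  shows "info \<pi> (4 * k + 2) = (if Suc \<pi> = 2 * M then (False, True) else (bit_at (val (Suc \<pi> div 2)) (k - 1), False))"
proof -
  obtain n where n: "\<pi> = 2 * n + 1" using assms(1) by (elim oddE)
  have j: "min (k - 1) ((4 * k + 2 - 2) div 4) = k - 1" by simp
  have Sk: "Suc (k - 1) = k" using k1 by simp
  have i: "info \<pi> (4 * k + 2) = (bit_at (val (Suc n)) (k - 1), 2 ^ k dvd val (Suc n))"
    using n j Sk k1 by (simp add: info_def)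
  show ?thesis
  proof (cases "Suc n = M")
    case True
    have "(2::nat) ^ k = 2 ^ (k - 1) * 2" using Sk by (metis power_Suc mult.commute)
    then have "bit_at (2 ^ k) (k - 1) = False" by (simp add: bit_at_def)
    then show ?thesis using i n True val_M by simp
  next
    case False
    then have "val (Suc n) < 2 ^ k" "0 < val (Suc n)" using assms n M2 by (auto simp: val_def)
    then have "\<not> 2 ^ k dvd val (Suc n)" by (meson dvd_imp_le not_le)
    then show ?thesis using i n False by simp
  qed
qed

lemma hi_turn: "odd \<pi> \<Longrightarrow> \<pi> < 2 * M \<Longrightarrow> hi \<pi> (4 * k + 2) = (if Suc \<pi> = 2 * M then 4 else 5)"
  using info_turn[of \<pi>] by (simp add: hi_def cls_hi_def cls_simps zag_floor_def)

lemma mod4_succ: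
  fixes u :: nat
  shows "u mod 4 = 0 \<Longrightarrow> Suc u mod 4 = 1" "u mod 4 = 1 \<Longrightarrow> Suc u mod 4 = 2"
    "u mod 4 = 2 \<Longrightarrow> Suc u mod 4 = 3" "u mod 4 = 3 \<Longrightarrow> Suc u mod 4 = 0"
  by presburger+

text \<open>The local rule of the tiles reproduces the closed form \<open>info\<close>. Only pockets
  need an argument: the half adder there is \<open>bit_at_Suc\<close> with
  \<open>dvd_Suc_bit_at\<close> on rightward passes and a copy on leftward ones.\<close>

lemma out_info_eq:
  assumes v: "Strip \<rho> \<pi> u e \<in> path_nodes"
  shows "out_info (cls \<pi>) u e (ininfo \<pi> u e) (read_bit \<pi> u) = info \<pi> u"
proof (cases "pocket (cls \<pi>) u e")
  case False
  then show ?thesis by (simp add: out_info_def ininfo_def)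
next
  case True
  then consider "cls \<pi> = 1" "u mod 4 = 2" "u < 4 * k + 2" | "cls \<pi> = 2" "u mod 4 = 0" "0 < u"
    by (auto simp: pocket_def)
  then show ?thesis
  proof cases
    case 1
    then have odd: "odd \<pi>" by (auto simp: cls_def split: if_splits)
    then obtain n where n: "\<pi> = 2 * n + 1" by (elim oddE)
    obtain j where j: "u = 4 * j + 2" using 1 by (metis mult_div_mod_eq)
    have jk: "j \<le> k - 1" using j 1 by simp
    have "(u - 1) div 4 = j" "\<pi> div 2 = n" using n j by simp_all
    then have r: "read_bit \<pi> u = bit_at (val n) j" by (simp only: read_bit_def)
    have o: "info \<pi> u = (bit_at (val (Suc n)) j, 2 ^ Suc j dvd val (Suc n))"
      using n j jk by (simp add: info_def)
    \<comment> \<open>The carry into bit \<open>j\<close> is the carry out of the preceding block;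
      for \<open>j = 0\<close> it is the initial carry, which makes the pass an increment.\<close>
    have c: "snd (info \<pi> (u - 1)) = (2 ^ j dvd val (Suc n))"
    proof (cases j)
      case (Suc i)
      have "(u - 1 - 2) div 4 = i" using j Suc by simp
      then show ?thesis using n j jk Suc by (simp add: info_def)
    qed (use n j in \<open>simp add: info_def\<close>)
    have "val (Suc n) = Suc (val n)" by (simp add: val_def)
    then show ?thesis using True odd r o c
      by (simp add: out_info_def ininfo_def bit_at_Suc dvd_Suc_bit_at del: power_Suc) 
  next
    case 2
    then have ev: "even \<pi>" "\<pi> \<noteq> 0" "\<pi> \<noteq> 2 * M" by (auto simp: cls_def split: if_splits)
    obtain i where i: "u = 4 * i + 0" using 2 by (metis mult_div_mod_eq)
    then obtain j where "i = Suc j" using 2 by (cases i) auto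
    with i have j: "u = 4 * j + 4" by simp
    have jk: "j \<le> k - 1" using j v by (auto simp: path_nodes_iff)
    have "(u - 1) div 4 = j" using j by simp
    then show ?thesis using True ev jk
      by (simp add: out_info_def ininfo_def info_def read_bit_def)
  qed
qed

lemma node_tile_Strip:
  assumes "Strip \<rho> \<pi> u e \<in> path_nodes"
  shows "node_tile (Strip \<rho> \<pi> u e) d = (let i' = info \<pi> u; c = cls \<pi>; d' = unrot \<rho> d in
     if d' = in_side c u e (snd i') then
       (if \<rho> = 0 \<and> c = 0 \<and> u = 4 * k + 2 \<and> e = 0 then 0 else enc (\<rho>, c, u, e, ininfo \<pi> u e))
     else if d' = out_side c u e (snd i') then
       (if \<rho> = 3 \<and> c = 3 \<and> u = 0 then 0 else enc (child_label \<rho> c u e i'))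
     else if neg_face c u e i' (read_bit \<pi> u) d' then 1
     else if \<rho> = 3 \<and> c = 1 \<and> u = 4 * k + 2 \<and> e = 3 \<and> snd i' \<and> d' = East then enc (4, 0, 0, 0, False, False)
     else 0)"
  using out_info_eq[OF assms] by (simp add: path_tile_def Let_def)

section \<open>Column profiles and crossings\<close>

lemma even_mod4: "even (u::nat) \<Longrightarrow> u mod 4 = 0 \<and> Suc u mod 4 = 1 \<or> u mod 4 = 2 \<and> Suc u mod 4 = 3"
  by presburger

lemma odd_mod4: "odd (u::nat) \<Longrightarrow> u mod 4 = 1 \<and> Suc u mod 4 = 2 \<or> u mod 4 = 3 \<and> Suc u mod 4 = 0"
  by presburger

lemma div4_pred: "u mod 4 \<noteq> 0 \<Longrightarrow> (u - 1) div 4 = u div (4::nat)"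
  by (cases u) (simp_all add: div_Suc)

text \<open>One equality for two crossings: at the tops on a rightward pass, and at the floors on a
  leftward one. \<open>zig_floor_odd\<close> does the same for the other pairs of columns, with
  floors and tops exchanged.\<close>

lemma zag_floor_even: "even u \<Longrightarrow> u \<le> 4 * k \<Longrightarrow> zag_floor (Suc u) = zag_floor u"
  using even_mod4[of u] by (cases "u = 0") (auto simp: zag_floor_def)

lemma zig_floor_odd: "odd u \<Longrightarrow> u \<le> 4 * k + 1 \<Longrightarrow> zig_floor (Suc u) = zig_floor u"
  using odd_mod4[of u] k1 by (cases "u = 4 * k + 1"; cases "u = 4 * k") (auto simp: zig_floor_def odd_pos)

lemma zig_floor_less_zag_floor: "1 \<le> u \<Longrightarrow> u \<le> 4 * k + 2 \<Longrightarrow> zig_floor u < zag_floor u"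
  unfolding zig_floor_def zag_floor_def by auto

lemma zag_floor_less_zig_floor: "u \<le> 4 * k + 1 \<Longrightarrow> zag_floor u < 4 + zig_floor u"
  unfolding zig_floor_def zag_floor_def using k1 by auto

lemma zag_floor_less_4: "u \<le> 4 * k + 1 \<Longrightarrow> zag_floor u < 4"
  unfolding zag_floor_def by auto

lemma g_vals: "zig_floor 0 = 3" "zag_floor 0 = 3" "zig_floor (Suc 0) = 0" "zag_floor (Suc 0) = 3" "zig_floor (4 * k + 1) = 1"
  "zig_floor (4 * k + 2) = 1" "zag_floor (4 * k + 1) = 2" "zag_floor (4 * k + 2) = 5"
  using k1 by (simp_all add: zig_floor_def zag_floor_def)

lemma lo_hi_0: "lo 0 u = 0" "hi 0 u = H + zig_floor u"
  by (simp_all add: lo_def hi_def cls_lo_def cls_hi_def cls_simps)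

lemma lo_hi_odd:
  assumes "odd \<pi>" "\<pi> \<le> 2 * M"
  shows "lo \<pi> u = zig_floor u"
    "hi \<pi> u = (if u = 4 * k + 2 then (if Suc \<pi> = 2 * M then 4 else 5) else zag_floor u)"
proof -
  show "lo \<pi> u = zig_floor u" using assms by (simp add: lo_def cls_lo_def cls_simps)
  have "\<pi> < 2 * M" using assms by (metis dvd_triv_left le_neq_implies_less)
  then show "hi \<pi> u = (if u = 4 * k + 2 then (if Suc \<pi> = 2 * M then 4 else 5) else zag_floor u)"
    using assms hi_turn[of \<pi>] by (cases "u = 4 * k + 2") (simp_all add: hi_def[of \<pi> u] cls_hi_def cls_simps)
qed

lemma lo_hi_even:
  assumes "even \<pi>" "0 < \<pi>" "\<pi> < 2 * M"
  shows "lo \<pi> u = zag_floor u" "hi \<pi> u = 4 + zig_floor u"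
  using assms by (simp_all add: lo_def hi_def cls_lo_def cls_hi_def cls_simps)

lemma lo_hi_fin: "lo (2 * M) u = min 4 (zag_floor u)" "hi (2 * M) u = 4"
  by (simp_all add: lo_def hi_def cls_lo_def cls_hi_def cls_simps)

lemma cls_odd: "cls \<pi> = 1 \<longleftrightarrow> odd \<pi>"
  "cls \<pi> = Suc 0 \<longleftrightarrow> odd \<pi>"
  by (auto simp: cls_def)

lemma in_side_eq: "in_side (cls \<pi>) u e (snd (info \<pi> u)) = (let h = (if odd \<pi> then West else East) in
     if even u then (if e = lo \<pi> u then h else South) else (if Suc e = hi \<pi> u then h else North))"
  unfolding in_side_def lo_def[symmetric] hi_def[symmetric] cls_odd ..

lemma out_side_eq: "out_side (cls \<pi>) u e (snd (info \<pi> u)) =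
   (let h = (if odd \<pi> then (if u = 4 * k + 2 then West else East)
       else if u > 0 then West else if \<pi> = 2 * M then North else East) in
     if even u then (if Suc e = hi \<pi> u then h else North)
     else (if e = lo \<pi> u then h else South))"
proof -
  have "cls \<pi> = 3 \<longleftrightarrow> \<pi> = 2 * M" using M1 by (auto simp: cls_def)
  then show ?thesis unfolding out_side_def lo_def[symmetric] hi_def[symmetric] cls_odd by simp
qed

lemma child_label_eq: "child_label \<rho> (cls \<pi>) u e (info \<pi> u) = (let i = info \<pi> u; h = (if odd \<pi>
         then (if u = 4 * k + 2 then (\<rho>, if snd i then 3 else 2, 4 * k + 1, e, i) else (\<rho>, 1, u + 1, e, i))
       else if u > 0 then (\<rho>, cls \<pi>, u - 1, e, i)
       else if \<pi> = 2 * M then (Suc \<rho>, 0, 4 * k + 2, 0, False, False) else (\<rho>, 1, 1, 2, False, True)) in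
     if even u then (if Suc e = hi \<pi> u then h else (\<rho>, cls \<pi>, u, Suc e, i))
     else (if e = lo \<pi> u then h else (\<rho>, cls \<pi>, u, e - 1, i)))"
proof -
  have "cls \<pi> = 3 \<longleftrightarrow> \<pi> = 2 * M" using M1 by (auto simp: cls_def)
  then show ?thesis unfolding child_label_def Let_def lo_def[symmetric] hi_def[symmetric] cls_odd by simp
qed

lemma pass_cases:
  assumes "\<pi> \<le> 2 * M"
  obtains "\<pi> = 0" | "odd \<pi>" "\<pi> < 2 * M" | "even \<pi>" "0 < \<pi>" "\<pi> < 2 * M" | "\<pi> = 2 * M"
  using assms by (metis dvd_triv_left le_neq_implies_less neq0_conv)

lemma lo_less_hi:
  assumes "\<pi> \<le> 2 * M"
    and "if odd \<pi> then 1 \<le> u \<and> u \<le> 4 * k + 2 else u \<le> 4 * k + 1 \<or> \<pi> = 0 \<and> u = 4 * k + 2"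
  shows "lo \<pi> u < hi \<pi> u"
  using assms(1)
proof (cases rule: pass_cases)
  case 1
  then show ?thesis using H1 by (simp add: lo_hi_0)
next
  case 2
  then show ?thesis using zig_floor_less_zag_floor[of u] assms g_vals by (auto simp: lo_hi_odd)
next
  case 3
  then show ?thesis using zag_floor_less_zig_floor[of u] assms by (auto simp: lo_hi_even)
next
  case 4
  then show ?thesis using zag_floor_less_4[of u] assms M1 by (auto simp: lo_hi_fin)
qed

lemma empty_cols: "\<pi> \<le> 2 * M \<Longrightarrow> odd \<pi> \<Longrightarrow> lo \<pi> 0 = hi \<pi> 0"
  "\<pi> \<le> 2 * M \<Longrightarrow> even \<pi> \<Longrightarrow> 0 < \<pi> \<Longrightarrow> lo \<pi> (4 * k + 2) = hi \<pi> (4 * k + 2)"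
proof -
  show "\<pi> \<le> 2 * M \<Longrightarrow> odd \<pi> \<Longrightarrow> lo \<pi> 0 = hi \<pi> 0"
    by (simp add: lo_hi_odd g_vals)
  show "\<pi> \<le> 2 * M \<Longrightarrow> even \<pi> \<Longrightarrow> 0 < \<pi> \<Longrightarrow> lo \<pi> (4 * k + 2) = hi \<pi> (4 * k + 2)"
    using g_vals by (cases "\<pi> = 2 * M") (simp_all add: lo_hi_even lo_hi_fin)
qed

lemma pocket_lo:
  assumes "pocket (cls \<pi>) u e" "\<pi> \<le> 2 * M"
  shows "even u \<and> e = lo \<pi> u \<and> 0 < u \<and> u < 4 * k + 2 \<or> u > 4 * k + 2"
proof -
  from assms consider "cls \<pi> = 1" "u mod 4 = 2" "u < 4 * k + 2" "e = 0"
    | "cls \<pi> = 2" "u mod 4 = 0" "0 < u" "e = 2"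
    by (auto simp: pocket_def)
  then show ?thesis
  proof cases
    case 1
    then have "odd \<pi>" "even u" by (simp add: cls_odd, presburger)
    then show ?thesis using 1 assms by (auto simp: lo_hi_odd zig_floor_def)
  next
    case 2
    then have "even \<pi>" "0 < \<pi>" "\<pi> < 2 * M" "even u" using assms(2) by (auto simp: cls_def split: if_splits)
    moreover have "u \<noteq> 4 * k + 2" using 2(2) by presburger
    ultimately show ?thesis using 2 assms by (auto simp: lo_hi_even zag_floor_def)
  qed
qed

text \<open>Outside the pockets the block index is constant. For \<open>u = 4 * k + 2\<close> this
  is due to the cap \<open>k - 1\<close>, which makes the turning column keep the result of the last
  bit.\<close>

lemma info_zig:
  assumes "odd \<pi>" "2 \<le> u" "u \<le> 4 * k + 2" "\<not> (u mod 4 = 2 \<and> u < 4 * k + 2)"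
  shows "info \<pi> (u - 1) = info \<pi> u"
proof -
  have "u \<noteq> 2" using assms k1 by auto
  then have "\<not> u \<le> 1" "\<not> u - 1 \<le> 1" using assms by auto
  moreover have "min (k - 1) ((u - 1 - 2) div 4) = min (k - 1) ((u - 2) div 4)"
  proof (cases "u = 4 * k + 2")
    case True
    have "(4 * k - Suc 0) div 4 = k - 1" using k1 by (cases k) simp_all
    then show ?thesis using True by simp
  next
    case False
    obtain v where v: "u = v + 2" using assms(2) le_Suc_ex by (metis add.commute)
    have "u mod 4 \<noteq> 2" using assms(3,4) False by auto
    then have "v mod 4 \<noteq> 0" unfolding v by presburger
    then have "(v - 1) div 4 = v div 4" by (rule div4_pred)
    then show ?thesis by (simp add: v)
  qed
  ultimately show ?thesis using assms(1) by (simp add: info_def)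
qed

lemma info_zag:
  assumes "even \<pi>" "u \<le> 4 * k + 1" "\<not> (u mod 4 = 0 \<and> 0 < u)" "\<pi> = 0 \<or> u \<le> 4 * k"
  shows "info \<pi> (u + 1) = info \<pi> u"
proof (cases "\<pi> = 0 \<or> \<pi> = 2 * M")
  case False
  then have "(u + 1 - 1) div 4 = (u - 1) div 4" using assms(3) div4_pred[of u] by (cases "u = 0") simp_all
  then show ?thesis using assms(1) by (simp add: info_def)
next
  case True
  then show ?thesis using assms(1) by (auto simp: info_def)
qed

section \<open>The path\<close>

text \<open>\<open>linked\<close> says that the second cell is a correct parent of the first one: it is adjacent on the
input side, and its output glue is the input glue of the first cell.\<close>

definition linked :: "nat \<Rightarrow> nat \<Rightarrow> nat \<Rightarrow> nat \<Rightarrow> nat \<Rightarrow> nat \<Rightarrow> nat \<Rightarrow> nat \<Rightarrow> bool" where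
  "linked \<rho> \<pi> u e \<rho>' \<pi>' u' e' \<longleftrightarrow> Strip \<rho>' \<pi>' u' e' \<in> path_nodes \<and>
     rotp \<rho>' (lpos \<pi>' u' e') = nb (rotp \<rho> (lpos \<pi> u e)) (rot \<rho> (in_side (cls \<pi>) u e (snd (info \<pi> u)))) \<and>
     rot \<rho>' (out_side (cls \<pi>') u' e' (snd (info \<pi>' u'))) = opp (rot \<rho> (in_side (cls \<pi>) u e (snd (info \<pi> u)))) \<and>
     child_label \<rho>' (cls \<pi>') u' e' (info \<pi>' u') = (\<rho>, cls \<pi>, u, e, ininfo \<pi> u e) \<and>
     \<not> (\<rho>' = 3 \<and> cls \<pi>' = 3 \<and> u' = 0)"

lemma linked_same:
  assumes "Strip \<rho> \<pi>' u' e' \<in> path_nodes"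
    "lpos \<pi>' u' e' = nb (lpos \<pi> u e) (in_side (cls \<pi>) u e (snd (info \<pi> u)))"
    "out_side (cls \<pi>') u' e' (snd (info \<pi>' u')) = opp (in_side (cls \<pi>) u e (snd (info \<pi> u)))"
    "child_label \<rho> (cls \<pi>') u' e' (info \<pi>' u') = (\<rho>, cls \<pi>, u, e, ininfo \<pi> u e)"
    "\<not> (\<pi>' = 2 * M \<and> u' = 0)"
  shows "linked \<rho> \<pi> u e \<rho> \<pi>' u' e'"
proof -
  have "cls \<pi>' = 3 \<longleftrightarrow> \<pi>' = 2 * M" using M1 by (auto simp: cls_def)
  then show ?thesis using assms by (simp add: linked_def rotp_nb rot_opp)
qed

text \<open>Inside a column the step is vertical and hands on the same information. At the first
  cell of a column the five cases are a crossing to the right, the start of a rightward pass, the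
  start of a copy, the right turn, and a crossing to the left.\<close>

lemma linked_par:
  assumes v: "Strip \<rho> \<pi> u e \<in> path_nodes" and ns: "Strip \<rho> \<pi> u e \<noteq> seed"
  shows "\<exists>\<rho>' \<pi>' u' e'. par (Strip \<rho> \<pi> u e) = Strip \<rho>' \<pi>' u' e' \<and> linked \<rho> \<pi> u e \<rho>' \<pi>' u' e'"
proof -
  have b: "\<rho> < 4" "\<pi> \<le> 2 * M" "u \<le> 4 * k + 2" "lo \<pi> u \<le> e" "e < hi \<pi> u"
    using v by (auto simp: path_nodes_iff)
  have cl: "odd \<pi> \<Longrightarrow> cls \<pi> = Suc 0" by (simp add: cls_odd)
  have fin0: "\<not> (\<pi> = 2 * M \<and> u = 0 \<and> lo \<pi> u < e)"
    using b by (cases "u = 0") (auto simp: lo_hi_fin g_vals)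
  show ?thesis
  proof (cases "even u \<and> lo \<pi> u < e \<or> odd u \<and> Suc e < hi \<pi> u")
    case True
    have np: "\<not> pocket (cls \<pi>) u e" using pocket_lo[of \<pi> u e] True b by auto
    show ?thesis
    proof (cases "even u")
      case ev: True
      have "linked \<rho> \<pi> u e \<rho> \<pi> u (e - 1)"
        by (rule linked_same)
          (use True ev b np fin0 in \<open>auto simp: path_nodes_iff lpos_def in_side_eq out_side_eq child_label_eq ininfo_def Let_def\<close>)
      then show ?thesis using True ev by auto
    next
      case od: False
      have "linked \<rho> \<pi> u e \<rho> \<pi> u (Suc e)"
        by (rule linked_same)
          (use True od odd_pos[of u] b np in \<open>auto simp: path_nodes_iff lpos_def in_side_eq out_side_eq child_label_eq ininfo_def Let_def\<close>)
      then show ?thesis using True od by auto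
    qed
  next
    case False
    have hp: "par (Strip \<rho> \<pi> u e) = hpar \<rho> \<pi> u e" using False by auto
    have first: "even u \<Longrightarrow> e = lo \<pi> u" "odd u \<Longrightarrow> Suc e = hi \<pi> u" using False b by auto
    consider (zig) "odd \<pi>" "u \<noteq> 1" | (zigstart) "odd \<pi>" "u = 1"
      | (strip) "even \<pi>" "u = 4 * k + 2" | (turn) "even \<pi>" "0 < \<pi>" "u = 4 * k + 1"
      | (zag) "even \<pi>" "u \<le> 4 * k + 1" "\<pi> = 0 \<or> u \<le> 4 * k"
      using b(3) by force
    then show ?thesis
    proof cases
      case zig
      have u: "2 \<le> u" using zig b empty_cols(1)[of \<pi>] by (cases "u = 0") auto
      have lh: "lo \<pi> (u - 1) < hi \<pi> (u - 1)"
      proof -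
        have "1 \<le> u - 1" "u - 1 \<le> 4 * k + 2" using u b by simp_all
        then show ?thesis using lo_less_hi[of \<pi> "u - 1"] zig b by simp
      qed
      have e1: "even u \<Longrightarrow> e = lo \<pi> (u - 1)"
        using first(1) zig_floor_odd[of "u - 1"] u b zig by (auto simp: lo_hi_odd)
      have e2: "odd u \<Longrightarrow> Suc e = hi \<pi> (u - 1)"
        using first(2) zag_floor_even[of "u - 1"] u b zig by (auto simp: lo_hi_odd)
      have i: "ininfo \<pi> u e = info \<pi> (u - 1)"
      proof (cases "u mod 4 = 2 \<and> u < 4 * k + 2")
        case True
        then have "even u" by presburger
        then have "e = 0" using first zig b True by (auto simp: lo_hi_odd zig_floor_def)
        then show ?thesis using True zig cl by (simp add: ininfo_def pocket_def)
      next
        case F: False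
        then show ?thesis using info_zig[of \<pi> u] zig cl u b by (auto simp: ininfo_def pocket_def)
      qed
      obtain v where v: "u = Suc v" using u by (cases u) auto
      have "linked \<rho> \<pi> u e \<rho> \<pi> (u - 1) e"
        by (rule linked_same; cases "even u"; (unfold in_side_eq out_side_eq child_label_eq Let_def)?)
          (use zig u v lh e1 e2 i b cl first in \<open>auto simp: path_nodes_iff lpos_def\<close>)
      then show ?thesis using zig hp by (auto simp: hpar_def)
    next
      case zigstart
      then have e: "e = 2" using first b k1 by (auto simp: lo_hi_odd g_vals)
      have "\<not> pocket (cls \<pi>) u e" using zigstart cl by (simp add: pocket_def)
      then have i: "ininfo \<pi> u e = (False, True)" using zigstart by (auto simp: ininfo_def info_def odd_pos)
      show ?thesis
      proof (cases "\<pi> = 1")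
        case True
        have "linked \<rho> \<pi> u e \<rho> 0 0 (e + H)"
          by (rule linked_same; (unfold in_side_eq out_side_eq child_label_eq Let_def)?)
            (use True zigstart e b cl i first M1 in \<open>auto simp: path_nodes_iff lpos_def lo_hi_0 g_vals base_def\<close>)
        then show ?thesis using True zigstart hp by (auto simp: hpar_def)
      next
        case F: False
        then have p: "even (\<pi> - 1)" "0 < \<pi> - 1" "\<pi> - 1 < 2 * M" using zigstart b by (auto elim: oddE)
        have "base \<pi> = base (\<pi> - 1) + 4"
        proof -
          obtain n where n: "\<pi> = 2 * n + 1" using zigstart by (elim oddE)
          then obtain n' where "n = Suc n'" using F by (cases n) auto
          then show ?thesis using n by (simp add: base_def)
        qed
        then have "linked \<rho> \<pi> u e \<rho> (\<pi> - 1) 0 (e + 4)"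
          by (intro linked_same; (unfold in_side_eq out_side_eq child_label_eq Let_def)?)
            (use F zigstart e b cl i p first in \<open>auto simp: path_nodes_iff lpos_def lo_hi_even g_vals\<close>)
        then show ?thesis using F zigstart hp by (auto simp: hpar_def)
      qed
    next
      case strip
      then have \<pi>: "\<pi> = 0" using b empty_cols(2)[of \<pi>] by (cases "\<pi> = 0") auto
      then have e: "e = 0" using first strip by (auto simp: lo_hi_0)
      then have "\<rho> \<noteq> 0" using ns \<pi> strip by (auto simp: seed_def)
      then obtain \<rho>' where \<rho>': "\<rho> = Suc \<rho>'" by (cases \<rho>) auto
      have "\<not> pocket (cls \<pi>) u e" using \<pi> by (simp add: pocket_def cls_simps)
      then have i: "ininfo \<pi> u e = (False, False)" using \<pi> by (simp add: ininfo_def info_def)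
      have ins: "in_side (cls \<pi>) u e (snd (info \<pi> u)) = East" using \<pi> strip e by (simp add: in_side_eq lo_hi_0)
      have out: "out_side (cls (2 * M)) 0 3 (snd (info (2 * M) 0)) = North"
        by (simp add: out_side_eq lo_hi_fin)
      \<comment> \<open>The final pass ends in the top row of column 0, directly below the first
        cell of the next copy, because the strip has length \<open>N - W\<close>.\<close>
      have bs: "int (base (2 * M) + 3) = int N - 1 - int (4 * k + 2) - 1"
        using M1 arg_cong[OF N_eq, of int] by (cases M) (auto simp: base_def)
      have nbp: "rotp \<rho>' (lpos (2 * M) 0 3) = nb (rotp \<rho> (lpos \<pi> u e)) (rot \<rho> East)"
      proof -
        have a: "nb (rotp (Suc 0) (lpos 0 (4 * k + 2) 0)) South = lpos (2 * M) 0 3"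
          unfolding lpos_def bs by (simp add: base_def)
        have b: "rotp i (rotp (Suc 0) p) = rotp (Suc i) p" for i p by (induction i) auto
        have c: "rot i South = rot (Suc i) East" for i by (induction i) auto
        have "rotp \<rho>' (lpos (2 * M) 0 3) = rotp \<rho>' (nb (rotp (Suc 0) (lpos 0 (4 * k + 2) 0)) South)"
          by (simp only: a)
        also have "\<dots> = nb (rotp (Suc \<rho>') (lpos 0 (4 * k + 2) 0)) (rot (Suc \<rho>') East)"
          by (simp only: rotp_nb b c)
        finally show ?thesis by (simp only: \<rho>' \<pi> strip e)
      qed
      have "rot \<rho>' North = opp (rot \<rho> East)"
      proof -
        have "rot (Suc \<rho>') East = rot \<rho>' South" by (induction \<rho>') auto
        then show ?thesis using \<rho>' rot_opp[of \<rho>' North] by simp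
      qed
      moreover have "Strip \<rho>' (2 * M) 0 3 \<in> path_nodes" using b \<rho>' by (simp add: path_nodes_iff lo_hi_fin g_vals)
      moreover have "child_label \<rho>' (cls (2 * M)) 0 3 (info (2 * M) 0) = (\<rho>, cls \<pi>, u, e, ininfo \<pi> u e)"
        unfolding child_label_eq using \<rho>' \<pi> e i strip by (simp add: lo_hi_fin cls_simps)
      ultimately have "linked \<rho> \<pi> u e \<rho>' (2 * M) 0 3"
        using ins out nbp b \<rho>' by (simp add: linked_def)
      then show ?thesis using strip hp \<rho>' by (auto simp: hpar_def)
    next
      case turn
      obtain \<pi>' where \<pi>': "\<pi> = Suc \<pi>'" "odd \<pi>'" "\<pi>' < 2 * M" using turn b by (cases \<pi>) auto
      have "\<not> pocket (cls \<pi>) u e" using turn pocket_lo[of \<pi> u e] b by auto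
      then have i: "ininfo \<pi> u e = info \<pi>' (4 * k + 2)"
        using \<pi>' turn info_turn[of \<pi>'] by (auto simp: ininfo_def info_def)
      have e: "Suc e = hi \<pi>' (4 * k + 2)"
      proof (cases "\<pi> = 2 * M")
        case True
        then show ?thesis using first turn lo_hi_fin \<pi>' lo_hi_odd(2)[of \<pi>' "4 * k + 2"] by auto
      next
        case F: False
        then show ?thesis using first turn lo_hi_even[of \<pi>] g_vals b \<pi>' lo_hi_odd(2)[of \<pi>' "4 * k + 2"] by auto
      qed
      \<comment> \<open>The carry at the turn selects the class of the next pass; this is how
        overflow starts the final pass.\<close>
      have c: "cls \<pi> = (if snd (info \<pi>' (4 * k + 2)) then 3 else 2)"
        using info_turn[of \<pi>'] \<pi>' by (auto simp: cls_def)
      have bs: "base \<pi> = base \<pi>'" using \<pi>' by (auto simp: base_def elim!: oddE)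
      have lh: "lo \<pi>' (4 * k + 2) < hi \<pi>' (4 * k + 2)" using lo_less_hi[of \<pi>' "4 * k + 2"] \<pi>' by auto
      have "linked \<rho> \<pi> u e \<rho> \<pi>' (4 * k + 2) e"
        by (rule linked_same; (unfold in_side_eq out_side_eq child_label_eq Let_def)?)
          (use turn \<pi>' e i c bs b lh first in \<open>auto simp: path_nodes_iff lpos_def\<close>)
      then show ?thesis using turn hp \<pi>' by (auto simp: hpar_def)
    next
      case zag
      have lh: "lo \<pi> (u + 1) < hi \<pi> (u + 1)"
      proof -
        have "u + 1 \<le> 4 * k + 1 \<or> \<pi> = 0 \<and> u + 1 = 4 * k + 2" using zag by linarith
        then show ?thesis using lo_less_hi[of \<pi> "u + 1"] zag b(2) by presburger
      qed
      have e1: "even u \<Longrightarrow> e = lo \<pi> (u + 1)"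
        using first(1) zag_floor_even[of u] b(2) zag
        by (cases rule: pass_cases[OF b(2)]) (auto simp: lo_hi_0 lo_hi_even lo_hi_fin)
      have e2: "odd u \<Longrightarrow> Suc e = hi \<pi> (u + 1)"
        using first(2) zig_floor_odd[of u] b(2) zag
        by (cases rule: pass_cases[OF b(2)]) (auto simp: lo_hi_0 lo_hi_even lo_hi_fin)
      have i: "ininfo \<pi> u e = info \<pi> (u + 1)"
      proof (cases "u mod 4 = 0 \<and> 0 < u")
        case True
        then have "even u" by presburger
        show ?thesis
        proof (cases "pocket (cls \<pi>) u e")
          case np: False
          have "cls \<pi> \<noteq> 2"
          proof
            assume c2: "cls \<pi> = 2"
            then have "0 < \<pi>" "\<pi> \<noteq> 2 * M" by (auto simp: cls_def split: if_splits)
            then have "e = 2" using first \<open>even u\<close> zag b True lo_hi_even[of \<pi> u] k1 by (auto simp: zag_floor_def split: if_splits)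
            then show False using np True c2 by (simp add: pocket_def)
          qed
          then have "\<pi> = 0 \<or> \<pi> = 2 * M" using zag by (auto simp: cls_def split: if_splits)
          then show ?thesis using np by (auto simp: ininfo_def info_def)
        qed (use zag in \<open>simp add: ininfo_def\<close>)
      next
        case F: False
        have "cls \<pi> \<noteq> Suc 0" using zag by (simp add: cls_odd)
        with F have "\<not> pocket (cls \<pi>) u e" by (auto simp: pocket_def)
        then show ?thesis using F info_zag[of \<pi> u] zag by (auto simp: ininfo_def)
      qed
      have "linked \<rho> \<pi> u e \<rho> \<pi> (u + 1) e"
        by (rule linked_same; cases "even u"; (unfold in_side_eq out_side_eq child_label_eq Let_def)?)
          (use zag lh e1 e2 i b cl first in \<open>auto simp: path_nodes_iff lpos_def\<close>)
      then show ?thesis using zag hp by (auto simp: hpar_def)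
    qed
  qed
qed

section \<open>The cells of the square\<close>

text \<open>The top profile of a pass is the floor of the next, so passes stack without gaps. At
  overflow, column \<open>4 * k + 2\<close> stops at height 4, which is the clipped floor
  \<open>min 4 5\<close> of the final pass.\<close>

lemma hi_lo_Suc:
  assumes "\<pi> < 2 * M" "u \<le> 4 * k + 2"
  shows "base \<pi> + hi \<pi> u = base (Suc \<pi>) + lo (Suc \<pi>) u"
proof (cases "even \<pi>")
  case True
  then obtain n where n: "\<pi> = 2 * n" by blast
  show ?thesis
  proof (cases n)
    case 0
    then show ?thesis using n assms by (simp add: lo_hi_0 lo_hi_odd base_def)
  next
    case (Suc i)
    then show ?thesis using n assms lo_hi_even[of \<pi> u] lo_hi_odd[of "Suc \<pi>" u] by (simp add: base_def)
  qed
next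
  case False
  then obtain n where n: "\<pi> = 2 * n + 1" by (elim oddE)
  have hi: "hi \<pi> u = (if u = 4 * k + 2 then (if Suc \<pi> = 2 * M then 4 else 5) else zag_floor u)"
    using lo_hi_odd[of \<pi> u] False assms by auto
  show ?thesis
  proof (cases "Suc \<pi> = 2 * M")
    case True
    have "u \<noteq> 4 * k + 2 \<Longrightarrow> zag_floor u < 4" using zag_floor_less_4[of u] assms by auto
    then have "hi \<pi> u = lo (Suc \<pi>) u"
      unfolding True lo_hi_fin hi using g_vals True by (cases "u = 4 * k + 2") auto
    then show ?thesis using n by (simp add: base_def)
  next
    case F: False
    then have "lo (Suc \<pi>) u = zag_floor u" using lo_hi_even[of "Suc \<pi>" u] False assms by auto
    then show ?thesis using hi F n g_vals by (auto simp: base_def)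
  qed
qed

lemma lo_le_hi:
  assumes "\<pi> \<le> 2 * M" "u \<le> 4 * k + 2"
  shows "lo \<pi> u \<le> hi \<pi> u"
proof (cases "odd \<pi>")
  case True
  then show ?thesis using lo_less_hi[OF assms(1), of u] assms empty_cols(1)[of \<pi>] by (cases "u = 0") auto
next
  case False
  then show ?thesis using lo_less_hi[OF assms(1), of u] assms empty_cols(2)[of \<pi>]
    by (cases "u = 4 * k + 2"; cases "\<pi> = 0") auto
qed

lemma height_mono:
  assumes "\<pi> \<le> \<pi>'" "\<pi>' \<le> 2 * M" "u \<le> 4 * k + 2"
  shows "base \<pi> + lo \<pi> u \<le> base \<pi>' + lo \<pi>' u"
  using assms
proof (induction rule: dec_induct)
  case (step i)
  then show ?case using hi_lo_Suc[of i u] lo_le_hi[of i u] by simp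
qed simp

lemma height_top: "base (2 * M) + hi (2 * M) u = H + 4 * M"
proof -
  have "(2 * M - 1) div 2 = M - 1" using M1 by (cases M) simp_all
  then have "base (2 * M) = H + 4 * (M - 1)" using M1 by (simp add: base_def)
  then show ?thesis using M1 by (simp add: lo_hi_fin)
qed

lemma row_bound:
  assumes "Strip \<rho> \<pi> u e \<in> path_nodes"
  shows "base \<pi> + e < H + 4 * M"
proof (cases "\<pi> = 2 * M")
  case True
  then show ?thesis using height_top[of u] assms by (auto simp: path_nodes_iff)
next
  case False
  then have "Suc \<pi> \<le> 2 * M" using assms by (auto simp: path_nodes_iff)
  have "base \<pi> + e < base (Suc \<pi>) + lo (Suc \<pi>) u"
    using hi_lo_Suc[of \<pi> u] assms False by (auto simp: path_nodes_iff)
  also have "base (Suc \<pi>) + lo (Suc \<pi>) u \<le> base (2 * M) + lo (2 * M) u"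
    using \<open>Suc \<pi> \<le> 2 * M\<close> assms by (intro height_mono) (auto simp: path_nodes_iff)
  also have "\<dots> \<le> H + 4 * M"
    using height_top[of u] lo_le_hi[of "2 * M" u] assms by (auto simp: path_nodes_iff)
  finally show ?thesis by simp
qed

lemma column_inj_aux:
  assumes "Strip \<rho> \<pi> u e \<in> path_nodes" "Strip \<rho>' \<pi>' u e' \<in> path_nodes" "\<pi> < \<pi>'"
  shows "base \<pi> + e < base \<pi>' + e'"
proof -
  have "base \<pi> + e < base (Suc \<pi>) + lo (Suc \<pi>) u"
    using hi_lo_Suc[of \<pi> u] assms by (auto simp: path_nodes_iff)
  also have "\<dots> \<le> base \<pi>' + lo \<pi>' u"
    using assms by (intro height_mono) (auto simp: path_nodes_iff)
  also have "\<dots> \<le> base \<pi>' + e'" using assms by (auto simp: path_nodes_iff)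
  finally show ?thesis .
qed

lemma column_inj:
  assumes "Strip \<rho> \<pi> u e \<in> path_nodes" "Strip \<rho>' \<pi>' u e' \<in> path_nodes" "base \<pi> + e = base \<pi>' + e'"
  shows "\<pi> = \<pi>' \<and> e = e'"
  using column_inj_aux[OF assms(1,2)] column_inj_aux[OF assms(2,1)] assms(3)
  by (cases "\<pi> = \<pi>'") (auto simp: nat_neq_iff)

lemma column_surj:
  assumes "\<rho> < 4" "u \<le> 4 * k + 2" "r < H + 4 * M"
  shows "\<exists>\<pi> e. Strip \<rho> \<pi> u e \<in> path_nodes \<and> base \<pi> + e = r"
proof -
  have "\<pi> \<le> 2 * M \<Longrightarrow> r < base \<pi> + hi \<pi> u \<Longrightarrow> ?thesis" for \<pi>
  proof (induction \<pi>)
    case 0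
    then show ?case using assms by (intro exI[of _ 0] exI[of _ r]) (simp add: path_nodes_iff lo_hi_0 base_def)
  next
    case (Suc \<pi>)
    show ?case
    proof (cases "base (Suc \<pi>) + lo (Suc \<pi>) u \<le> r")
      case True
      then show ?thesis using Suc.prems assms
        by (intro exI[of _ "Suc \<pi>"] exI[of _ "r - base (Suc \<pi>)"]) (auto simp: path_nodes_iff)
    next
      case False
      then show ?thesis using Suc hi_lo_Suc[of \<pi> u] assms by auto
    qed
  qed
  from this[of "2 * M"] show ?thesis using assms height_top[of u] by simp
qed

section \<open>The pinwheel of four rectangles\<close>

lemma less_4_cases: "(\<rho>::nat) < 4 \<Longrightarrow> \<rho> = 0 \<or> \<rho> = Suc 0 \<or> \<rho> = Suc (Suc 0) \<or> \<rho> = Suc (Suc (Suc 0))"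
  by linarith

lemma box_inj:
  assumes "\<rho> < 4" "\<rho>' < 4" "u \<le> 4 * k + 2" "u' \<le> 4 * k + 2" "r < H + 4 * M" "r' < H + 4 * M"
    and "rotp \<rho> (int u, int r) = rotp \<rho>' (int u', int r')"
  shows "\<rho> = \<rho>' \<and> u = u' \<and> r = r'"
proof -
  have n: "int N = 4 * int k + 3 + (int H + 4 * int M)" "2 * (4 * int k + 3) < int N"
    using N_eq N_big by (simp_all flip: of_nat_less_iff[where 'a = int])
  from assms have b: "int u \<le> 4 * int k + 2" "int u' \<le> 4 * int k + 2"
    "int r < int H + 4 * int M" "int r' < int H + 4 * int M" by linarith+
  show ?thesis
    using less_4_cases[OF assms(1)] less_4_cases[OF assms(2)] assms(7) n b
    by (elim disjE; simp; linarith?)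
qed

lemma Strip_inj:
  assumes "Strip \<rho> \<pi> u e \<in> path_nodes" "Strip \<rho>' \<pi>' u' e' \<in> path_nodes"
    "npos (Strip \<rho> \<pi> u e) = npos (Strip \<rho>' \<pi>' u' e')"
  shows "Strip \<rho> \<pi> u e = Strip \<rho>' \<pi>' u' e'"
proof -
  have "\<rho> = \<rho>' \<and> u = u' \<and> base \<pi> + e = base \<pi>' + e'"
    using assms row_bound[OF assms(1)] row_bound[OF assms(2)]
    by (intro box_inj) (auto simp: path_nodes_iff lpos_def)
  then show ?thesis using column_inj[of \<rho> \<pi> u e \<rho>' \<pi>' e'] assms by auto
qed

lemma box_outside:
  assumes "\<rho> < 4" "u \<le> 4 * k + 2" "r < H + 4 * M"
    "W \<le> x" "x < N - W" "W \<le> y" "y < N - W"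
  shows "rotp \<rho> (int u, int r) \<noteq> (int x, int y)"
proof -
  have n: "int N = 4 * int k + 3 + (int H + 4 * int M)"
    using N_eq by linarith
  from assms have b: "int u \<le> 4 * int k + 2" "int r < int H + 4 * int M"
     "4 * int k + 3 \<le> int x" "4 * int k + 3 \<le> int y" "int x < int N - (4 * int k + 3)" "int y < int N - (4 * int k + 3)"
    by (auto simp: W_def)
  show ?thesis
    using less_4_cases[OF assms(1)] n b by (elim disjE; simp; linarith?)
qed

lemma inj_npos: "inj_on npos I"
proof (rule inj_onI)
  fix p q assume pq: "p \<in> I" "q \<in> I" "npos p = npos q"
  have pf: False if "Strip \<rho> \<pi> u e \<in> I" "Fill x y \<in> I" "npos (Strip \<rho> \<pi> u e) = npos (Fill x y)" for \<rho> \<pi> u e x y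
    using that box_outside[of \<rho> u "base \<pi> + e" x y] row_bound[of \<rho> \<pi> u e]
    by (auto simp: I_Strip I_Fill path_nodes_iff lpos_def)
  show "p = q"
  proof (cases p; cases q)
    fix \<rho> \<pi> u e \<rho>' \<pi>' u' e' assume "p = Strip \<rho> \<pi> u e" "q = Strip \<rho>' \<pi>' u' e'"
    then show ?thesis using pq Strip_inj by (metis I_Strip)
  next
    fix \<rho> \<pi> u e x y assume "p = Strip \<rho> \<pi> u e" "q = Fill x y"
    then show ?thesis using pq pf by blast
  next
    fix \<rho> \<pi> u e x y assume "p = Fill x y" "q = Strip \<rho> \<pi> u e"
    then show ?thesis using pq pf[of \<rho> \<pi> u e x y] by auto
  next
    fix x y x' y' assume "p = Fill x y" "q = Fill x' y'"
    then show ?thesis using pq by simp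
  qed
qed

lemma Strip_at:
  assumes "\<rho> < 4" "0 \<le> x" "x \<le> int (4 * k + 2)" "0 \<le> y" "y < int (H + 4 * M)"
  shows "\<exists>\<pi> e. Strip \<rho> \<pi> (nat x) e \<in> path_nodes \<and> lpos \<pi> (nat x) e = (x, y)"
proof -
  obtain \<pi> e where "Strip \<rho> \<pi> (nat x) e \<in> path_nodes" "base \<pi> + e = nat y"
    using column_surj[of \<rho> "nat x" "nat y"] assms by (auto simp: nat_le_iff nat_less_iff)
  then show ?thesis using assms by (intro exI[of _ \<pi>] exI[of _ e]) (auto simp: lpos_def)
qed

text \<open>Used with \<open>a = W - 1\<close> and \<open>b = N - W\<close>: the first four
  alternatives are the arms of the pinwheel, the last one is the interior.\<close>

lemma pinwheel:
  fixes a b x y :: int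
  assumes "a < b"
  shows "x \<le> a \<and> y < b \<or> x < b \<and> b \<le> y \<or> b \<le> x \<and> a < y \<or> a < x \<and> y \<le> a \<or>
    a < x \<and> x < b \<and> a < y \<and> y < b"
  using assms by linarith

lemma npos_image: "npos ` I = square N"
proof
  have n: "int N = 4 * int k + 3 + (int H + 4 * int M)" "2 * (4 * int k + 3) < int N"
    using N_eq N_big by (simp_all flip: of_nat_less_iff[where 'a = int])
  have nW: "int (N - W) = int N - (4 * int k + 3)" using N_big by (simp add: W_def)
  show "npos ` I \<subseteq> square N"
  proof (rule image_subsetI)
    fix p assume p: "p \<in> I"
    show "npos p \<in> square N"
    proof (cases p)
      case (Strip \<rho> \<pi> u e)
      then have v: "Strip \<rho> \<pi> u e \<in> path_nodes" using p I_Strip by simp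
      then have b: "int u \<le> 4 * int k + 2" "int (base \<pi> + e) < int H + 4 * int M" "\<rho> < 4"
        using row_bound[OF v] by (auto simp: path_nodes_iff)
      have "rotp \<rho> (int u, int (base \<pi> + e)) \<in> square N"
        unfolding square_def using less_4_cases[OF b(3)] n b(1,2)
        by (elim disjE; simp; linarith?)
      then show ?thesis using Strip by (simp add: lpos_def)
    next
      case (Fill x y)
      then show ?thesis using p by (auto simp: I_Fill square_def)
    qed
  qed
  show "square N \<subseteq> npos ` I"
  proof
    fix z assume "z \<in> square N"
    then obtain x y where z: "z = (x, y)" "0 \<le> x" "x < int N" "0 \<le> y" "y < int N"
      by (auto simp: square_def)
    have ex: "z \<in> npos ` I" if "\<rho> < 4" "0 \<le> u" "u \<le> int (4 * k + 2)" "0 \<le> r" "r < int (H + 4 * M)" "rotp \<rho> (u, r) = z" for \<rho> u r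
    proof -
      have "\<exists>\<pi> e. Strip \<rho> \<pi> (nat u) e \<in> path_nodes \<and> lpos \<pi> (nat u) e = (u, r)"
        using that by (intro Strip_at)
      then obtain \<pi> e where "Strip \<rho> \<pi> (nat u) e \<in> path_nodes" "lpos \<pi> (nat u) e = (u, r)" by blast
      then show ?thesis using that I_Strip by (intro image_eqI[of _ _ "Strip \<rho> \<pi> (nat u) e"]) auto
    qed
    consider "x \<le> int (4 * k + 2)" "y < int (H + 4 * M)"
      | "x < int (H + 4 * M)" "int (H + 4 * M) \<le> y"
      | "int (H + 4 * M) \<le> x" "int (4 * k + 2) < y"
      | "int (4 * k + 2) < x" "y \<le> int (4 * k + 2)"
      | "int (4 * k + 2) < x" "x < int (H + 4 * M)" "int (4 * k + 2) < y" "y < int (H + 4 * M)"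
      using pinwheel[of "int (4 * k + 2)" "int (H + 4 * M)" x y] n by fastforce
    then show "z \<in> npos ` I"
    proof cases
      case 1
      then show ?thesis using z n by (intro ex[of 0 x y]) auto
    next
      case 2
      then show ?thesis using z n by (intro ex[of "Suc 0" "int N - 1 - y" x]) auto
    next
      case 3
      then show ?thesis using z n by (intro ex[of "Suc (Suc 0)" "int N - 1 - x" "int N - 1 - y"]) auto
    next
      case 4
      then show ?thesis using z n by (intro ex[of "Suc (Suc (Suc 0))" y "int N - 1 - x"]) auto
    next
      case 5
      then have "Fill (nat x) (nat y) \<in> I" using z n nW by (auto simp: I_Fill W_def)
      then show ?thesis using z by (intro image_eqI[of _ _ "Fill (nat x) (nat y)"]) auto
    qed
  qed
qed

lemma finite_I: "finite I"
proof -
  have "finite (npos ` I)" unfolding npos_image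
    by (rule finite_subset[of _ "{0..<int N} \<times> {0..<int N}"]) (auto simp: square_def)
  then show ?thesis using inj_npos finite_imageD by blast
qed

section \<open>The path as a linear order\<close>

lemma linked_parD:
  assumes "p \<in> path_nodes" "p \<noteq> seed"
  shows "par p \<in> path_nodes" "npos (par p) = nb (npos p) (ins p)"
proof -
  obtain \<rho> \<pi> u e where p: "p = Strip \<rho> \<pi> u e" using assms by (auto simp: path_nodes_def)
  obtain \<rho>' \<pi>' u' e' where "par p = Strip \<rho>' \<pi>' u' e'" "linked \<rho> \<pi> u e \<rho>' \<pi>' u' e'"
    using linked_par assms p by blast
  then show "par p \<in> path_nodes" "npos (par p) = nb (npos p) (ins p)"
    using p by (auto simp: linked_def)
qed

text \<open>The carry affects only the height of column \<open>4 * k + 2\<close>, which is even,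
  whereas the top is consulted only in odd columns.\<close>

lemma in_side_indep: "in_side c u e cy = in_side c u e cy'"
  by (auto simp: in_side_def cls_hi_def Let_def)

definition fin_node :: node where "fin_node = Strip 3 (2 * M) 0 3"

text \<open>The common output glue determines copy, class, column and height of the child, but not
  its pass. It does fix the input side, so both children sit on the same side of the same cell and
  coincide.\<close>

lemma par_inj:
  assumes "p \<in> path_nodes" "p \<noteq> seed" "q \<in> path_nodes" "q \<noteq> seed" "par p = par q"
  shows "p = q"
proof -
  obtain \<rho> \<pi> u e where p: "p = Strip \<rho> \<pi> u e" using assms by (auto simp: path_nodes_def)
  obtain \<rho>1 \<pi>1 u1 e1 where q: "q = Strip \<rho>1 \<pi>1 u1 e1" using assms by (auto simp: path_nodes_def)
  obtain \<rho>' \<pi>' u' e' where "par p = Strip \<rho>' \<pi>' u' e'" "linked \<rho> \<pi> u e \<rho>' \<pi>' u' e'"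
    "linked \<rho>1 \<pi>1 u1 e1 \<rho>' \<pi>' u' e'"
    using linked_par[of \<rho> \<pi> u e] linked_par[of \<rho>1 \<pi>1 u1 e1] assms p q by auto
  then have "\<rho> = \<rho>1" "cls \<pi> = cls \<pi>1" "u = u1" "e = e1" by (auto simp: linked_def)
  then have "ins p = ins q" using p q in_side_indep[of "cls \<pi>" u e "snd (info \<pi> u)" "snd (info \<pi>1 u)"] by simp
  then have "nb (npos p) (ins p) = nb (npos q) (ins p)"
    using linked_parD[of p] linked_parD[of q] assms by simp
  then have "npos p = npos q" by (simp add: nb_inj)
  then show ?thesis using assms inj_npos by (auto simp: inj_on_def I_def)
qed

lemma seed_in: "seed \<in> path_nodes"
  using H1 by (simp add: seed_def path_nodes_iff lo_hi_0)

lemma fin_node_in: "fin_node \<in> path_nodes"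
  by (simp add: fin_node_def path_nodes_iff lo_hi_fin g_vals)

text \<open>A counting argument turns the existence of parents into the existence of children.\<close>

lemma par_image: "par ` (path_nodes - {seed}) = path_nodes - {fin_node}"
proof -
  have f: "finite path_nodes" using finite_I by (simp add: I_def)
  have "par ` (path_nodes - {seed}) \<subseteq> path_nodes - {fin_node}"
  proof (rule image_subsetI)
    fix p assume p: "p \<in> path_nodes - {seed}"
    then obtain \<rho> \<pi> u e where pe: "p = Strip \<rho> \<pi> u e" by (auto simp: path_nodes_def)
    have "par p \<noteq> fin_node"
      using linked_par[of \<rho> \<pi> u e] p pe by (auto simp: linked_def fin_node_def cls_simps simp del: par.simps)
    then show "par p \<in> path_nodes - {fin_node}" using linked_parD p by auto
  qed
  moreover have "card (par ` (path_nodes - {seed})) = card (path_nodes - {seed})"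
    by (rule card_image) (auto simp: inj_on_def intro: par_inj)
  then have "card (par ` (path_nodes - {seed})) = card (path_nodes - {fin_node})"
    using f seed_in fin_node_in by simp
  ultimately show ?thesis using f by (intro card_subset_eq) auto
qed

text \<open>The order of visits: copy, pass, progress across the columns, progress within the
  column.\<close>

fun key :: "node \<Rightarrow> nat \<times> nat \<times> nat \<times> nat" where
  "key (Strip \<rho> \<pi> u e) = (\<rho>, \<pi>, if odd \<pi> then u else W - u, if even u then e else hi \<pi> u - e)"
| "key (Fill x y) = (4, 0, x, y)"

abbreviation "lexo \<equiv> less_than <*lex*> (less_than <*lex*> (less_than <*lex*> less_than))"

lemma par_key:
  assumes "p \<in> I" "p \<noteq> seed"
  shows "(key (par p), key p) \<in> lexo"
proof (cases p)
  case (Fill x y)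
  then show ?thesis by auto
next
  case (Strip \<rho> \<pi> u e)
  then have v: "Strip \<rho> \<pi> u e \<in> path_nodes" using assms I_Strip by simp
  then have b: "\<rho> < 4" "\<pi> \<le> 2 * M" "u \<le> 4 * k + 2" "lo \<pi> u \<le> e" "e < hi \<pi> u"
    by (auto simp: path_nodes_iff)
  have hk: "(key (hpar \<rho> \<pi> u e), key p) \<in> lexo" if first: "even u \<Longrightarrow> e = lo \<pi> u"
  proof -
    have f1: "odd \<pi> \<Longrightarrow> u \<noteq> 0" using b empty_cols(1)[of \<pi>] by (cases "u = 0") auto
    have f2: "even \<pi> \<Longrightarrow> u = 4 * k + 2 \<Longrightarrow> \<rho> \<noteq> 0"
    proof
      assume a: "even \<pi>" "u = 4 * k + 2" "\<rho> = 0"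
      then have "\<pi> = 0" using b empty_cols(2)[of \<pi>] by (cases "\<pi> = 0") auto
      then show False using a b assms Strip first by (auto simp: seed_def lo_hi_0)
    qed
    have f3: "W - Suc u < W - u" using b by (simp add: W_def)
    consider "odd \<pi>" "u = 1" | "odd \<pi>" "u \<noteq> 1" | "even \<pi>" "u = 4 * k + 2"
      | "even \<pi>" "u \<noteq> 4 * k + 2" "u = 4 * k + 1 \<and> \<pi> > 0"
      | "even \<pi>" "u \<noteq> 4 * k + 2" "\<not> (u = 4 * k + 1 \<and> \<pi> > 0)"
      by blast
    then show ?thesis
      unfolding Strip hpar_def by cases (use f1 f2 f3 b k1 in \<open>auto simp: odd_pos\<close>)
  qed
  consider "even u" "lo \<pi> u < e" | "odd u" "Suc e < hi \<pi> u"
    | "par p = hpar \<rho> \<pi> u e" "even u \<longrightarrow> e = lo \<pi> u"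
    using Strip b by (cases "even u"; cases "lo \<pi> u < e"; cases "Suc e < hi \<pi> u") auto
  then show ?thesis
  proof cases
    case 1
    then show ?thesis using Strip by auto
  next
    case 2
    then have "hi \<pi> u - Suc e < hi \<pi> u - e" by linarith
    then show ?thesis using Strip 2 by auto
  next
    case 3
    then show ?thesis using hk by simp
  qed
qed

abbreviation "ParI \<equiv> {(par p, p) | p. p \<in> I - {seed}}"
abbreviation "ParP \<equiv> {(par p, p) | p. p \<in> path_nodes - {seed}}"

lemma wf_ParI: "wf ParI"
proof (rule wf_subset)
  show "wf (inv_image lexo key)" by (intro wf_inv_image wf_lex_prod wf_less_than)
  show "ParI \<subseteq> inv_image lexo key" using par_key by (auto simp: inv_image_def)
qed

lemma ParP_trancl: "(p, q) \<in> ParP\<^sup>* \<Longrightarrow> p = q \<or> (key p, key q) \<in> lexo"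
proof (induction rule: rtrancl_induct)
  case (step y z)
  then have "(key y, key z) \<in> lexo" using par_key by (auto simp: I_def)
  moreover have "trans lexo" by (intro trans_lex_prod trans_less_than)
  ultimately show ?case using step.IH by (metis transD)
qed simp

lemma seed_anc: "p \<in> path_nodes \<Longrightarrow> (seed, p) \<in> ParP\<^sup>*"
proof (induction p rule: wf_induct_rule[OF wf_ParI])
  case (1 p)
  show ?case
  proof (cases "p = seed")
    case False
    then have "(par p, p) \<in> ParI" "par p \<in> path_nodes" "(par p, p) \<in> ParP" using 1 linked_parD by (auto simp: I_def)
    then show ?thesis using 1 by (meson rtrancl.rtrancl_into_rtrancl)
  qed simp
qed

text \<open>Every node has at most one child on the path, so two nodes reached from the seed are
  comparable; the key excludes the wrong direction. Ancestry thus reduces to comparing keys.\<close>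

lemma key_anc:
  assumes "p \<in> path_nodes" "q \<in> path_nodes" "(key p, key q) \<in> lexo"
  shows "(p, q) \<in> ParI\<^sup>*"
proof -
  have "single_valued ParP" using par_inj by (auto simp: single_valued_def)
  then have "(p, q) \<in> ParP\<^sup>* \<or> (q, p) \<in> ParP\<^sup>*"
    by (rule single_valued_confluent[OF _ seed_anc[OF assms(1)] seed_anc[OF assms(2)]])
  moreover have "(q, p) \<notin> ParP\<^sup>*"
  proof
    assume "(q, p) \<in> ParP\<^sup>*"
    then have "q = p \<or> (key q, key p) \<in> lexo" by (rule ParP_trancl)
    moreover have "wf lexo" by (intro wf_lex_prod wf_less_than)
    ultimately show False using assms(3) wf_not_refl[of lexo] wf_not_sym[of lexo] by metis
  qed
  moreover have "ParP\<^sup>* \<subseteq> ParI\<^sup>*" by (rule rtrancl_mono) (auto simp: I_def)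
  ultimately show ?thesis by blast
qed

section \<open>Reading and writing bits\<close>

lemma node_tile_negD:
  assumes "Strip \<rho> \<pi> u e \<in> path_nodes" "node_tile (Strip \<rho> \<pi> u e) d = Suc 0"
  shows "neg_face (cls \<pi>) u e (info \<pi> u) (read_bit \<pi> u) (unrot \<rho> d)"
  using assms(2) unfolding node_tile_Strip[OF assms(1)] Let_def by (simp split: if_splits)

lemma node_tile_neg_iff:
  assumes "Strip \<rho> \<pi> u e \<in> path_nodes"
    "in_side (cls \<pi>) u e (snd (info \<pi> u)) \<noteq> d" "out_side (cls \<pi>) u e (snd (info \<pi> u)) \<noteq> d"
  shows "node_tile (Strip \<rho> \<pi> u e) (rot \<rho> d) = Suc 0 \<longleftrightarrow> neg_face (cls \<pi>) u e (info \<pi> u) (read_bit \<pi> u) d"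
  using assms(2,3) unfolding node_tile_Strip[OF assms(1)] Let_def by auto

lemma node_tile_Fill_neg: "node_tile (Fill x y) d \<noteq> Suc 0"
  by simp

lemma mod4_eqs: "(4 * j + 2) mod 4 = (2::nat)" "(4 * j + 3) mod 4 = (3::nat)" "(4 * j + 4) mod 4 = (0::nat)"
  "(4 * j + 1) div 4 = (j::nat)" "(4 * j + 2) div 4 = (j::nat)" "(4 * j + 3) div 4 = (j::nat)" "4 * j div 4 = (j::nat)"
  by presburger+

lemma g_cols:
  assumes "j < k"
  shows "zig_floor (4 * j + 2) = 0" "zag_floor (4 * j + 2) = 3" "zig_floor (4 * j + 3) = 1" "zag_floor (4 * j + 3) = 3"
    "zig_floor (4 * j + 4) = 1" "zag_floor (4 * j + 4) = 2"
  using assms unfolding zig_floor_def zag_floor_def by (simp_all only: mod4_eqs) auto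

text \<open>The writers are the topmost cells of columns \<open>4 j + 2\<close> and
  \<open>4 j + 3\<close> of the previous pass. The case \<open>\<pi> = 1\<close> is separate because
  there they belong to the initial pass, at heights depending on \<open>H\<close>, and take their
  bit from \<open>val 0\<close> instead of the path.\<close>

lemma zig_pocket_nbs:
  assumes \<rho>: "\<rho> < 4" and \<pi>: "odd \<pi>" "\<pi> \<le> 2 * M" and j: "j < k"
  shows "\<exists>es ew. Strip \<rho> (\<pi> - 1) (4 * j + 2) es \<in> path_nodes \<and> Strip \<rho> (\<pi> - 1) (4 * j + 3) ew \<in> path_nodes \<and>
    base (\<pi> - 1) + es + 1 = base \<pi> \<and> base (\<pi> - 1) + ew = base \<pi> \<and>
    (node_tile (Strip \<rho> (\<pi> - 1) (4 * j + 2) es) (rot \<rho> North) = Suc 0 \<longleftrightarrow> \<not> read_bit \<pi> (4 * j + 2)) \<and>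
    (node_tile (Strip \<rho> (\<pi> - 1) (4 * j + 3) ew) (rot \<rho> West) = Suc 0 \<longleftrightarrow> read_bit \<pi> (4 * j + 2))"
proof -
  have a: "4 * j + 2 - 1 = 4 * j + 1" "4 * j + 3 - 1 = 4 * j + 2" "min (k - 1) j = j" using j by auto
  show ?thesis
  proof (cases "\<pi> = 1")
    case True
    have s: "Strip \<rho> (\<pi> - 1) (4 * j + 2) (H - 1) \<in> path_nodes" "Strip \<rho> (\<pi> - 1) (4 * j + 3) H \<in> path_nodes"
      using True \<rho> j H1 g_cols[OF j] by (simp_all add: path_nodes_iff lo_hi_0)
    have r: "read_bit \<pi> (4 * j + 2) = bit_at (val 0) j" using True a mod4_eqs by (simp only: read_bit_def) simp
    have "node_tile (Strip \<rho> (\<pi> - 1) (4 * j + 2) (H - 1)) (rot \<rho> North) = Suc 0 \<longleftrightarrow> \<not> bit_at (val 0) j"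
      by (subst node_tile_neg_iff[OF s(1)]; (unfold in_side_eq out_side_eq)?)
        (use True g_cols[OF j] H1 mod4_eqs[of j] a M1 j in \<open>simp_all add: lo_hi_0 neg_face_def cls_simps pocket_def del: add_2_eq_Suc'\<close>)
    moreover have "node_tile (Strip \<rho> (\<pi> - 1) (4 * j + 3) H) (rot \<rho> West) = Suc 0 \<longleftrightarrow> bit_at (val 0) j"
      by (subst node_tile_neg_iff[OF s(2)]; (unfold in_side_eq out_side_eq)?)
        (use True g_cols[OF j] H1 mod4_eqs[of j] a M1 j in \<open>simp_all add: lo_hi_0 neg_face_def cls_simps pocket_def\<close>)
    ultimately show ?thesis using s True H1 r
      by (intro exI[of _ "H - 1"] exI[of _ H]) (simp add: base_def)
  next
    case False
    obtain n where n: "\<pi> = 2 * n + 1" using \<pi> by (elim oddE)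
    obtain n' where n': "n = Suc n'" using n False by (cases n) auto
    have p: "even (\<pi> - 1)" "0 < \<pi> - 1" "\<pi> - 1 < 2 * M" "\<pi> - 1 = 2 * n" using n n' \<pi> by auto
    have c: "cls (\<pi> - 1) = 2" using p by (simp add: cls_simps)
    have i: "fst (info (\<pi> - 1) (4 * j + 2)) = bit_at (val n) j" "fst (info (\<pi> - 1) (4 * j + 3)) = bit_at (val n) j"
      using p a mod4_eqs[of j] by (simp_all only: info_def) simp_all
    have s: "Strip \<rho> (\<pi> - 1) (4 * j + 2) 3 \<in> path_nodes" "Strip \<rho> (\<pi> - 1) (4 * j + 3) 4 \<in> path_nodes"
      using p \<rho> j g_cols[OF j] by (simp_all add: path_nodes_iff lo_hi_even)
    have r: "read_bit \<pi> (4 * j + 2) = bit_at (val n) j" using n a mod4_eqs by (simp only: read_bit_def) simp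
    have "node_tile (Strip \<rho> (\<pi> - 1) (4 * j + 2) 3) (rot \<rho> North) = Suc 0 \<longleftrightarrow> \<not> bit_at (val n) j"
      by (subst node_tile_neg_iff[OF s(1)]; (unfold in_side_eq out_side_eq)?; (unfold c)?)
        (use p g_cols[OF j] mod4_eqs[of j] i in \<open>simp_all add: lo_hi_even neg_face_def pocket_def\<close>)
    moreover have "node_tile (Strip \<rho> (\<pi> - 1) (4 * j + 3) 4) (rot \<rho> West) = Suc 0 \<longleftrightarrow> bit_at (val n) j"
      by (subst node_tile_neg_iff[OF s(2)]; (unfold in_side_eq out_side_eq)?; (unfold c)?)
        (use p g_cols[OF j] mod4_eqs[of j] i in \<open>simp_all add: lo_hi_even neg_face_def pocket_def\<close>)
    moreover have "base \<pi> = base (\<pi> - 1) + 4" using n n' by (simp add: base_def)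
    ultimately show ?thesis using s r
      by (intro exI[of _ 3] exI[of _ 4]) simp
  qed
qed

lemma zag_pocket_nbs:
  assumes \<rho>: "\<rho> < 4" and \<pi>: "even \<pi>" "0 < \<pi>" "\<pi> < 2 * M" and j: "j < k"
  shows "Strip \<rho> (\<pi> - 1) (4 * j + 4) 1 \<in> path_nodes \<and> Strip \<rho> (\<pi> - 1) (4 * j + 3) 2 \<in> path_nodes \<and>
    base (\<pi> - 1) = base \<pi> \<and>
    (node_tile (Strip \<rho> (\<pi> - 1) (4 * j + 4) 1) (rot \<rho> North) = Suc 0 \<longleftrightarrow> \<not> read_bit \<pi> (4 * j + 4)) \<and>
    (node_tile (Strip \<rho> (\<pi> - 1) (4 * j + 3) 2) (rot \<rho> East) = Suc 0 \<longleftrightarrow> read_bit \<pi> (4 * j + 4))"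
proof -
  have a: "4 * j + 4 - 1 = 4 * j + 3" "4 * j + 4 - 2 = 4 * j + 2" "4 * j + 3 - 2 = 4 * j + 1" "min (k - 1) j = j"
    using j by auto
  obtain n where n: "\<pi> = 2 * n" using \<pi> by blast
  obtain n' where n': "n = Suc n'" using n \<pi> by (cases n) auto
  have p: "odd (\<pi> - 1)" "\<pi> - 1 \<le> 2 * M" using n n' \<pi> by auto
  have d: "Suc ((\<pi> - 1) div 2) = n" using n n' by simp
  have c: "cls (\<pi> - 1) = 1" using p by (simp add: cls_odd)
  have i: "fst (info (\<pi> - 1) (4 * j + 4)) = bit_at (val n) j" "fst (info (\<pi> - 1) (4 * j + 3)) = bit_at (val n) j"
    using p a mod4_eqs[of j] d by (simp_all only: info_def) (auto simp: odd_pos)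
  have s: "Strip \<rho> (\<pi> - 1) (4 * j + 4) 1 \<in> path_nodes" "Strip \<rho> (\<pi> - 1) (4 * j + 3) 2 \<in> path_nodes"
    using p \<rho> j g_cols[OF j] by (auto simp: path_nodes_iff lo_hi_odd)
  have r: "read_bit \<pi> (4 * j + 4) = bit_at (val n) j" using n a mod4_eqs by (simp only: read_bit_def) simp
  have "node_tile (Strip \<rho> (\<pi> - 1) (4 * j + 4) 1) (rot \<rho> North) = Suc 0 \<longleftrightarrow> \<not> bit_at (val n) j"
    by (subst node_tile_neg_iff[OF s(1)]; (unfold in_side_eq out_side_eq)?; (unfold c)?)
      (use p g_cols[OF j] mod4_eqs[of j] i in \<open>auto simp: lo_hi_odd neg_face_def pocket_def\<close>)
  moreover have "node_tile (Strip \<rho> (\<pi> - 1) (4 * j + 3) 2) (rot \<rho> East) = Suc 0 \<longleftrightarrow> bit_at (val n) j"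
    by (subst node_tile_neg_iff[OF s(2)]; (unfold in_side_eq out_side_eq)?; (unfold c)?)
      (use p g_cols[OF j] mod4_eqs[of j] i j in \<open>auto simp: lo_hi_odd neg_face_def pocket_def\<close>)
  moreover have "base \<pi> = base (\<pi> - 1)" using n n' by (simp add: base_def)
  ultimately show ?thesis using s r by simp
qed

definition wall :: "nat \<Rightarrow> side" where
  "wall \<pi> = (if odd \<pi> then East else West)"

lemma pocket_nbs:
  assumes v: "Strip \<rho> \<pi> u e \<in> path_nodes" and p: "pocket (cls \<pi>) u e"
  shows "\<exists>u1 e1 u2 e2. Strip \<rho> (\<pi> - 1) u1 e1 \<in> path_nodes \<and> Strip \<rho> (\<pi> - 1) u2 e2 \<in> path_nodes \<and> 0 < \<pi> \<and>
    lpos (\<pi> - 1) u1 e1 = nb (lpos \<pi> u e) South \<and> lpos (\<pi> - 1) u2 e2 = nb (lpos \<pi> u e) (wall \<pi>) \<and>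
    (node_tile (Strip \<rho> (\<pi> - 1) u1 e1) (rot \<rho> North) = Suc 0 \<longleftrightarrow> \<not> read_bit \<pi> u) \<and>
    (node_tile (Strip \<rho> (\<pi> - 1) u2 e2) (rot \<rho> (opp (wall \<pi>))) = Suc 0 \<longleftrightarrow> read_bit \<pi> u)"
proof -
  have b: "\<rho> < 4" "\<pi> \<le> 2 * M" "u \<le> 4 * k + 2" using v by (auto simp: path_nodes_iff)
  from p consider "odd \<pi>" "u mod 4 = 2" "u < 4 * k + 2" "e = 0"
    | "even \<pi>" "0 < \<pi>" "\<pi> < 2 * M" "u mod 4 = 0" "0 < u" "e = 2"
    using b(2) by (auto simp: pocket_def cls_def split: if_splits)
  then show ?thesis
  proof cases
    case 1
    define j where "j = u div 4"
    have u: "u = 4 * j + 2" using 1 mult_div_mod_eq[of 4 u] by (simp add: j_def)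
    then have j: "j < k" using 1 by simp
    obtain es ew where E: "Strip \<rho> (\<pi> - 1) (4 * j + 2) es \<in> path_nodes" "Strip \<rho> (\<pi> - 1) (4 * j + 3) ew \<in> path_nodes"
      "base (\<pi> - 1) + es + 1 = base \<pi>" "base (\<pi> - 1) + ew = base \<pi>"
      "node_tile (Strip \<rho> (\<pi> - 1) (4 * j + 2) es) (rot \<rho> North) = Suc 0 \<longleftrightarrow> \<not> read_bit \<pi> (4 * j + 2)"
      "node_tile (Strip \<rho> (\<pi> - 1) (4 * j + 3) ew) (rot \<rho> West) = Suc 0 \<longleftrightarrow> read_bit \<pi> (4 * j + 2)"
      using zig_pocket_nbs[OF b(1) 1(1) b(2) j] by blast
    have "lpos (\<pi> - 1) (4 * j + 2) es = nb (lpos \<pi> u e) South"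
      unfolding lpos_def u using 1 E(3) by simp
    moreover have "lpos (\<pi> - 1) (4 * j + 3) ew = nb (lpos \<pi> u e) (wall \<pi>)"
      unfolding lpos_def u wall_def E(4) using 1 by simp
    moreover have "wall \<pi> = East" "0 < \<pi>" using 1 by (auto simp: wall_def odd_pos)
    ultimately show ?thesis using E unfolding u
      by (intro exI[of _ "4 * j + 2"] exI[of _ "4 * j + 3"] exI[of _ es] exI[of _ ew]) (simp del: node_tile.simps)
  next
    case 2
    obtain i where i: "u = 4 * i" using 2 by (metis mult_div_mod_eq add.right_neutral)
    then obtain j where "i = Suc j" using 2 by (cases i) auto
    with i have u: "u = 4 * j + 4" by simp
    then have j: "j < k" using b by simp
    note E = zag_pocket_nbs[OF b(1) 2(1,2,3) j]
    have "lpos (\<pi> - 1) (4 * j + 4) 1 = nb (lpos \<pi> u e) South"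
      "lpos (\<pi> - 1) (4 * j + 3) 2 = nb (lpos \<pi> u e) (wall \<pi>)"
      unfolding lpos_def u wall_def using 2 E by simp_all
    moreover have "wall \<pi> = West" using 2 by (auto simp: wall_def)
    ultimately show ?thesis using E 2 unfolding u
      by (intro exI[of _ "4 * j + 4"] exI[of _ "4 * j + 3"] exI[of _ 1] exI[of _ 2]) (simp del: node_tile.simps)
  qed
qed

lemma npos_eqD: "p \<in> I \<Longrightarrow> q \<in> I \<Longrightarrow> npos p = npos q \<Longrightarrow> p = q"
  using inj_npos by (auto simp: inj_on_def)

text \<open>The right reader has its negative glue on the side whose writer is silent for the bit
  being read.\<close>

lemma reader_no_conflict:
  assumes v: "Strip \<rho> \<pi> u e \<in> path_nodes" and p: "pocket (cls \<pi>) u e"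
    and d: "d = South \<or> d = wall \<pi>" and a: "node_tile (Strip \<rho> \<pi> u e) (rot \<rho> d) = Suc 0"
    and q: "q \<in> I" "npos q = nb (npos (Strip \<rho> \<pi> u e)) (rot \<rho> d)"
  shows "node_tile q (rot \<rho> (opp d)) \<noteq> Suc 0"
proof -
  obtain u1 e1 u2 e2 where E: "Strip \<rho> (\<pi> - 1) u1 e1 \<in> path_nodes" "Strip \<rho> (\<pi> - 1) u2 e2 \<in> path_nodes"
    "lpos (\<pi> - 1) u1 e1 = nb (lpos \<pi> u e) South" "lpos (\<pi> - 1) u2 e2 = nb (lpos \<pi> u e) (wall \<pi>)"
    "node_tile (Strip \<rho> (\<pi> - 1) u1 e1) (rot \<rho> North) = Suc 0 \<longleftrightarrow> \<not> read_bit \<pi> u"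
    "node_tile (Strip \<rho> (\<pi> - 1) u2 e2) (rot \<rho> (opp (wall \<pi>))) = Suc 0 \<longleftrightarrow> read_bit \<pi> u"
    using pocket_nbs[OF v p] by blast
  have n: "neg_face (cls \<pi>) u e (info \<pi> u) (read_bit \<pi> u) d"
    using node_tile_negD[OF v a] by simp
  have w: "wall \<pi> \<noteq> South" by (simp add: wall_def)
  show ?thesis
  proof (cases "d = South")
    case True
    then have "read_bit \<pi> u" using n by (auto simp: neg_face_def Let_def split: if_splits)
    moreover have "q = Strip \<rho> (\<pi> - 1) u1 e1"
      using q True E(1,3) by (intro npos_eqD) (auto simp: I_Strip rotp_nb simp del: nb.simps)
    ultimately show ?thesis using E(5) True by simp
  next
    case False
    then have dw: "d = wall \<pi>" using d by simp
    then have "\<not> read_bit \<pi> u"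
      using n p by (auto simp: neg_face_def Let_def wall_def pocket_def cls_odd split: if_splits)
    moreover have "q = Strip \<rho> (\<pi> - 1) u2 e2"
      using q dw E(2,4) by (intro npos_eqD) (auto simp: I_Strip rotp_nb simp del: nb.simps)
    ultimately show ?thesis using E(6) dw by simp
  qed
qed

text \<open>Sorts negative faces so that, of two facing each other, one must belong to a reader. The
  bound in the second case keeps the cell above a writer inside the same strip.\<close>

lemma neg_cases:
  assumes "Strip \<rho> \<pi> u e \<in> path_nodes" "node_tile (Strip \<rho> \<pi> u e) d = Suc 0"
  obtains "pocket (cls \<pi>) u e" "unrot \<rho> d = South \<or> unrot \<rho> d = wall \<pi>"
  | "unrot \<rho> d = North" "base \<pi> + e + 1 < H + 4 * M"
  | "unrot \<rho> d = East" "u mod 4 = 3"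
  | "unrot \<rho> d = West" "u mod 4 = 3"
proof -
  have b: "\<rho> < 4" "\<pi> \<le> 2 * M" "u \<le> 4 * k + 2" "lo \<pi> u \<le> e" "e < hi \<pi> u" using assms(1) by (auto simp: path_nodes_iff)
  have n: "neg_face (cls \<pi>) u e (info \<pi> u) (read_bit \<pi> u) (unrot \<rho> d)" by (rule node_tile_negD[OF assms])
  show thesis
  proof (cases "unrot \<rho> d = North")
    case True
    then have "cls \<pi> = 1 \<and> u mod 4 = 0 \<or> cls \<pi> = 2 \<and> u mod 4 = 2 \<or> cls \<pi> = 0 \<and> Suc e = H"
      using n by (auto simp: neg_face_def Let_def split: if_splits)
    then have "base \<pi> + e + 1 < H + 4 * M"
    proof (elim disjE conjE)
      assume c: "cls \<pi> = 1" "u mod 4 = 0"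
      then have "odd \<pi>" by (simp add: cls_odd)
      then obtain n where "\<pi> = 2 * n + 1" by (elim oddE)
      moreover have "u \<noteq> 4 * k + 2" using c(2) by presburger
      ultimately have "e < zag_floor u" "base \<pi> = H + 4 * n" "n < M"
        using b lo_hi_odd[of \<pi> u] by (auto simp: base_def)
      moreover have "zag_floor u \<le> 3" using \<open>u \<noteq> 4 * k + 2\<close> by (simp add: zag_floor_def)
      ultimately show ?thesis by linarith
    next
      assume c: "cls \<pi> = 2" "u mod 4 = 2"
      then have p: "even \<pi>" "0 < \<pi>" "\<pi> < 2 * M" using b by (auto simp: cls_def split: if_splits)
      then obtain n where n: "\<pi> = 2 * n" by blast
      then obtain n' where n': "n = Suc n'" using p by (cases n) auto
      have "base \<pi> = H + 4 * n'" "Suc n' < M" using n n' p by (auto simp: base_def)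
      moreover have "e < 4 + zig_floor u" "zig_floor u \<le> 3" using b lo_hi_even[OF p] by (auto simp: zig_floor_def)
      ultimately show ?thesis by linarith
    next
      assume c: "cls \<pi> = 0" "Suc e = H"
      then have "\<pi> = 0" by (auto simp: cls_def split: if_splits)
      then show ?thesis using c M1 by (simp add: base_def)
    qed
    then show thesis using True that(2) by blast
  next
    case False
    then show thesis
      using n that by (auto simp: neg_face_def Let_def wall_def cls_odd split: if_splits)
  qed
qed

text \<open>Two writers never face each other: a writer's North face meets a South face, which is
  negative only on readers, and a side face in a column congruent to 3 modulo 4 meets a column that
  is not. So one of the two tiles is a reader and \<open>reader_no_conflict\<close> applies.\<close>

lemma no_conflict_Strip:
  assumes p: "p \<in> I" and q: "q \<in> I" and pq: "npos q = nb (npos p) d"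
    and a: "node_tile p d = Suc 0" "node_tile q (opp d) = Suc 0"
  shows False
proof -
  obtain \<rho> \<pi> u e where pe: "p = Strip \<rho> \<pi> u e" using a(1) node_tile_Fill_neg by (cases p) auto
  obtain \<rho>' \<pi>' u' e' where qe: "q = Strip \<rho>' \<pi>' u' e'" using a(2) node_tile_Fill_neg by (cases q) auto
  have v: "Strip \<rho> \<pi> u e \<in> path_nodes" "Strip \<rho>' \<pi>' u' e' \<in> path_nodes" using p q pe qe I_Strip by auto
  have qp: "npos p = nb (npos q) (opp d)" using pq by (metis nb_nb_opp(1))
  have b: "\<rho> < 4" "u \<le> 4 * k + 2" "\<rho>' < 4" "u' \<le> 4 * k + 2" using v by (auto simp: path_nodes_iff)
  have rp: False if "pocket (cls \<pi>) u e" "unrot \<rho> d = South \<or> unrot \<rho> d = wall \<pi>"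
    using reader_no_conflict[OF v(1) that, of q] a pq q pe by (simp add: rot_opp del: node_tile.simps npos.simps)
  have rq: False if "pocket (cls \<pi>') u' e'" "unrot \<rho>' (opp d) = South \<or> unrot \<rho>' (opp d) = wall \<pi>'"
    using reader_no_conflict[OF v(2) that, of p] a qp p qe by (simp add: rot_opp del: node_tile.simps npos.simps)
  \<comment> \<open>A neighbouring position inside the rectangle of copy \<open>\<rho>\<close> is
    already taken by a cell of that copy, which must be \<open>q\<close>.\<close>
  have same: "\<rho>' = \<rho> \<and> u' = nat x" if "nb (lpos \<pi> u e) (unrot \<rho> d) = (x, y)"
    "0 \<le> x" "x \<le> int (4 * k + 2)" "0 \<le> y" "y < int (H + 4 * M)" for x y
  proof -
    have "\<exists>\<pi>1 e1. Strip \<rho> \<pi>1 (nat x) e1 \<in> path_nodes \<and> lpos \<pi>1 (nat x) e1 = (x, y)"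
      using that b(1) by (intro Strip_at)
    then obtain \<pi>1 e1 where w: "Strip \<rho> \<pi>1 (nat x) e1 \<in> path_nodes" "lpos \<pi>1 (nat x) e1 = (x, y)"
      by blast
    have "npos (Strip \<rho> \<pi>1 (nat x) e1) = rotp \<rho> (nb (lpos \<pi> u e) (unrot \<rho> d))" using w that by simp
    also have "\<dots> = npos q" using pq pe by (simp add: rotp_nb)
    finally have "Strip \<rho> \<pi>1 (nat x) e1 = q" using w q by (intro npos_eqD) (auto simp: I_Strip)
    then show ?thesis using qe by simp
  qed
  note rb = row_bound[OF v(1)]
  show False
  proof (rule neg_cases[OF v(1) a(1)[unfolded pe]])
    assume N: "unrot \<rho> d = North" "base \<pi> + e + 1 < H + 4 * M"
    have "\<rho>' = \<rho>" using same[of "int u" "int (base \<pi> + e) + 1"] N b by (simp add: lpos_def)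
    then have "unrot \<rho>' (opp d) = South" using N by (simp add: unrot_opp)
    then show False using rq by (elim neg_cases[OF v(2) a(2)[unfolded qe]]) (auto simp: wall_def)
  next
    assume E: "unrot \<rho> d = East" "u mod 4 = 3"
    have "u < 4 * k + 2" using E(2) b(2) by presburger
    then have s: "\<rho>' = \<rho>" "u' = Suc u"
      using same[of "int u + 1" "int (base \<pi> + e)"] E b rb by (auto simp: lpos_def nat_add_distrib)
    then have "unrot \<rho>' (opp d) = West" "u' mod 4 \<noteq> 3" using E mod4_succ[of u] by (auto simp: unrot_opp)
    then show False using rq by (elim neg_cases[OF v(2) a(2)[unfolded qe]]) auto
  next
    assume E: "unrot \<rho> d = West" "u mod 4 = 3"
    have u: "0 < u" using E(2) by (cases u) auto
    then have s: "\<rho>' = \<rho>" "u = Suc u'"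
      using same[of "int u - 1" "int (base \<pi> + e)"] E b rb by (auto simp: lpos_def)
    then have "unrot \<rho>' (opp d) = East" "u' mod 4 \<noteq> 3" using E mod4_succ[of u'] by (auto simp: unrot_opp)
    then show False using rq by (elim neg_cases[OF v(2) a(2)[unfolded qe]]) auto
  qed (use rp in blast)
qed

section \<open>Correctness of the counter system\<close>

definition exit_node :: node where "exit_node = Strip 3 (2 * M - 1) (4 * k + 2) 3"

lemma exit_pass: "odd (2 * M - 1)" "2 * M - 1 < 2 * M" "Suc (2 * M - 1) = 2 * M" "2 * M - 1 \<le> 2 * M"
  using M1 by auto

lemma exit_node_in: "exit_node \<in> path_nodes"
  using lo_hi_odd[OF exit_pass(1,4)] exit_pass g_vals by (simp add: exit_node_def path_nodes_iff)

lemma in_label: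
  assumes "Strip \<rho> \<pi> u e \<in> path_nodes" "Strip \<rho> \<pi> u e \<noteq> seed"
  shows "node_tile (Strip \<rho> \<pi> u e) (ins (Strip \<rho> \<pi> u e)) = enc (\<rho>, cls \<pi>, u, e, ininfo \<pi> u e)"
proof -
  have "\<not> (\<rho> = 0 \<and> cls \<pi> = 0 \<and> u = 4 * k + 2 \<and> e = 0)"
    using assms(2) M1 by (auto simp: seed_def cls_def split: if_splits)
  then show ?thesis unfolding node_tile_Strip[OF assms(1)] by (simp add: Let_def)
qed

lemma seed_face: "node_tile seed (ins seed) = 0"
  using node_tile_Strip[OF seed_in[unfolded seed_def]] by (simp add: seed_def Let_def cls_simps)

text \<open>Only a turning column enters and leaves by the same side of the column; there the claim
  holds because the column has more than one cell.\<close>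

lemma in_side_neq_out_side:
  assumes "Strip \<rho> \<pi> u e \<in> path_nodes"
  shows "in_side (cls \<pi>) u e (snd (info \<pi> u)) \<noteq> out_side (cls \<pi>) u e (snd (info \<pi> u))"
proof -
  have b: "\<pi> \<le> 2 * M" "u \<le> 4 * k + 2" "lo \<pi> u \<le> e" "e < hi \<pi> u" using assms by (auto simp: path_nodes_iff)
  have "Suc (lo \<pi> (4 * k + 2)) \<noteq> hi \<pi> (4 * k + 2)" if "odd \<pi>"
    using lo_hi_odd[OF that b(1)] g_vals by auto
  moreover have "Suc (lo \<pi> 0) \<noteq> hi \<pi> 0" if "even \<pi>" "\<pi> \<noteq> 2 * M"
    using b(1) that H1 by (cases rule: pass_cases[OF b(1)]) (auto simp: lo_hi_0 lo_hi_even g_vals)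
  ultimately show ?thesis
    unfolding in_side_eq out_side_eq Let_def using b by (auto split: if_splits)
qed

lemma out_label:
  assumes "Strip \<rho> \<pi> u e \<in> path_nodes" "\<not> (\<rho> = 3 \<and> cls \<pi> = 3 \<and> u = 0)"
    "unrot \<rho> d = out_side (cls \<pi>) u e (snd (info \<pi> u))"
  shows "node_tile (Strip \<rho> \<pi> u e) d = enc (child_label \<rho> (cls \<pi>) u e (info \<pi> u))"
  using in_side_neq_out_side[OF assms(1)] assms(2,3) unfolding node_tile_Strip[OF assms(1)] Let_def by auto

lemma exit_face: "node_tile exit_node North = enc (4, 0, 0, 0, False, False)"
proof -
  have "snd (info (2 * M - 1) (4 * k + 2))" using info_turn[OF exit_pass(1,2)] exit_pass(3) by simp
  moreover have "unrot 3 North = East" by (simp add: numeral_3_eq_3)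
  moreover have "in_side (cls (2 * M - 1)) (4 * k + 2) 3 (snd (info (2 * M - 1) (4 * k + 2))) \<noteq> East"
    "out_side (cls (2 * M - 1)) (4 * k + 2) 3 (snd (info (2 * M - 1) (4 * k + 2))) \<noteq> East"
    unfolding in_side_eq out_side_eq Let_def using exit_pass by auto
  moreover have "(4 * k + 2) mod 4 \<noteq> 3" by presburger
  then have "\<not> neg_face (cls (2 * M - 1)) (4 * k + 2) 3 (info (2 * M - 1) (4 * k + 2)) (read_bit (2 * M - 1) (4 * k + 2)) East"
    using exit_pass by (auto simp: neg_face_def pocket_def cls_odd Let_def)
  moreover have "cls (2 * M - 1) = 1" using exit_pass by (simp add: cls_odd)
  ultimately show ?thesis
    unfolding exit_node_def node_tile_Strip[OF exit_node_in[unfolded exit_node_def]] Let_def by simp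
qed

lemma Strip_faces:
  assumes v: "Strip \<rho> \<pi> u e \<in> path_nodes" and a: "node_tile (Strip \<rho> \<pi> u e) d \<noteq> Suc 0" "node_tile (Strip \<rho> \<pi> u e) d \<noteq> 0"
  obtains "d = ins (Strip \<rho> \<pi> u e)" "Strip \<rho> \<pi> u e \<noteq> seed"
  | "unrot \<rho> d = out_side (cls \<pi>) u e (snd (info \<pi> u))" "Strip \<rho> \<pi> u e \<noteq> fin_node"
    "node_tile (Strip \<rho> \<pi> u e) d = enc (child_label \<rho> (cls \<pi>) u e (info \<pi> u))"
  | "Strip \<rho> \<pi> u e = exit_node" "d = North"
proof -
  let ?d = "unrot \<rho> d" and ?i = "snd (info \<pi> u)"
  consider "?d = in_side (cls \<pi>) u e ?i"
    | "?d \<noteq> in_side (cls \<pi>) u e ?i" "?d = out_side (cls \<pi>) u e ?i" "\<not> (\<rho> = 3 \<and> cls \<pi> = 3 \<and> u = 0)"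
    | "\<rho> = 3" "cls \<pi> = 1" "u = 4 * k + 2" "e = 3" ?i "?d = East"
    using a unfolding node_tile_Strip[OF v] Let_def by (auto split: if_splits)
  then show thesis
  proof cases
    case 1
    then have d: "d = ins (Strip \<rho> \<pi> u e)" by (metis ins.simps(1) rot_unrot)
    moreover have "Strip \<rho> \<pi> u e \<noteq> seed" using d a(2) seed_face by metis
    ultimately show thesis using that(1) by blast
  next
    case 2
    have "Strip \<rho> \<pi> u e \<noteq> fin_node" using 2(3) by (auto simp: fin_node_def cls_simps)
    then show thesis using that(2) 2 out_label[OF v 2(3,2)] by blast
  next
    case 3
    have \<pi>: "odd \<pi>" "\<pi> < 2 * M" using 3 v by (auto simp: cls_odd path_nodes_iff nat_less_le)
    then have "\<pi> = 2 * M - 1" using info_turn[of \<pi>] 3 by (auto split: if_splits)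
    moreover have "d = rot 3 East" using 3 by (metis rot_unrot)
    then have "d = North" by (simp add: numeral_3_eq_3)
    ultimately show thesis using that(3) 3 by (simp add: exit_node_def)
  qed
qed

lemma child:
  assumes v: "Strip \<rho> \<pi> u e \<in> path_nodes" and "Strip \<rho> \<pi> u e \<noteq> fin_node"
  obtains \<rho>' \<pi>' u' e' where "Strip \<rho>' \<pi>' u' e' \<in> path_nodes" "Strip \<rho>' \<pi>' u' e' \<noteq> seed"
    "par (Strip \<rho>' \<pi>' u' e') = Strip \<rho> \<pi> u e" "linked \<rho>' \<pi>' u' e' \<rho> \<pi> u e"
proof -
  have "Strip \<rho> \<pi> u e \<in> par ` (path_nodes - {seed})" using assms par_image by auto
  then obtain p where "p \<in> path_nodes - {seed}" "Strip \<rho> \<pi> u e = par p" by (rule imageE)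
  then have p: "p \<in> path_nodes" "p \<noteq> seed" "par p = Strip \<rho> \<pi> u e" by auto
  obtain \<rho>' \<pi>' u' e' where pe: "p = Strip \<rho>' \<pi>' u' e'" using p by (auto simp: path_nodes_def)
  then have "linked \<rho>' \<pi>' u' e' \<rho> \<pi> u e" using linked_par[of \<rho>' \<pi>' u' e'] p by auto
  then show thesis using that p pe by blast
qed

lemma fill_anc: "Fill x y \<in> I \<Longrightarrow> (exit_node, Fill x y) \<in> ParI\<^sup>*"
proof (induction "x + y" arbitrary: x y rule: less_induct)
  case less
  have st: "(par (Fill x y), Fill x y) \<in> ParI" using less.prems by (auto simp: seed_def)
  show ?case
  proof (cases "par (Fill x y) = exit_node")
    case True
    then show ?thesis using st by auto
  next
    case False
    then obtain x' y' where p: "par (Fill x y) = Fill x' y'" "x' + y' < x + y" "Fill x' y' \<in> I"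
      using less.prems by (auto simp: exit_node_def I_Fill split: if_splits)
    then show ?thesis using less.hyps[OF p(2,3)] st by (metis (no_types, lifting) rtrancl.rtrancl_into_rtrancl)
  qed
qed

text \<open>All of copies 0 to 2 precedes the exit cell in copy 3, from which every interior cell
  descends.\<close>

lemma strip_before_fill:
  assumes "\<rho> < 3" "0 \<le> r" "r < int (H + 4 * M)" "Fill x y \<in> I"
  shows "\<exists>q\<in>I. (q, Fill x y) \<in> ParI\<^sup>* \<and> npos q = rotp \<rho> (int (4 * k + 2), r)"
proof -
  have "\<exists>\<pi> e. Strip \<rho> \<pi> (nat (int (4 * k + 2))) e \<in> path_nodes \<and> lpos \<pi> (nat (int (4 * k + 2))) e = (int (4 * k + 2), r)"
    using assms by (intro Strip_at) auto
  then obtain \<pi> e where v: "Strip \<rho> \<pi> (4 * k + 2) e \<in> path_nodes" "lpos \<pi> (4 * k + 2) e = (int (4 * k + 2), r)"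
    by (metis nat_int)
  have "(Strip \<rho> \<pi> (4 * k + 2) e, exit_node) \<in> ParI\<^sup>*"
    using v exit_node_in assms(1) by (intro key_anc) (auto simp: exit_node_def)
  then have "(Strip \<rho> \<pi> (4 * k + 2) e, Fill x y) \<in> ParI\<^sup>*" using fill_anc[OF assms(4)] by (metis (no_types, lifting) rtrancl_trans)
  then show ?thesis using v by (intro bexI[of _ "Strip \<rho> \<pi> (4 * k + 2) e"]) (simp_all add: I_Strip)
qed

lemma par_in_I: "p \<in> I \<Longrightarrow> p \<noteq> seed \<Longrightarrow> par p \<in> I"
  using linked_parD(1)[of p] exit_node_in
  by (cases p) (auto simp: I_def fill_nodes_def exit_node_def simp del: par.simps(1))

lemma exit_pos: "npos exit_node = (int W, int W - 1)"
proof -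
  have "(2 * M - 1 - 1) div 2 = M - 1" using M1 by (cases M) simp_all
  then have "base (2 * M - 1) = H + 4 * (M - 1)" using M1 by (simp add: base_def)
  then have "int (base (2 * M - 1) + 3) = int N - 1 - int W" using N_eq M1 by (simp add: W_def)
  then have "lpos (2 * M - 1) (4 * k + 2) 3 = (int W - 1, int N - 1 - int W)"
    by (simp add: lpos_def W_def)
  then show ?thesis by (simp add: exit_node_def numeral_3_eq_3)
qed

lemma par_npos: "p \<in> I \<Longrightarrow> p \<noteq> seed \<Longrightarrow> npos (par p) = nb (npos p) (ins p)"
proof (cases p)
  case (Strip \<rho> \<pi> u e)
  then show "p \<in> I \<Longrightarrow> p \<noteq> seed \<Longrightarrow> ?thesis" using linked_parD(2)[of p] I_Strip by auto
next
  case (Fill x y)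
  then show "p \<in> I \<Longrightarrow> p \<noteq> seed \<Longrightarrow> ?thesis"
    using exit_pos by (auto simp: I_Fill exit_node_def of_nat_diff simp del: npos.simps(1))
qed

lemma edge:
  assumes "p \<in> I" "p \<noteq> seed"
  shows "node_tile (par p) (opp (ins p)) = node_tile p (ins p) \<and> node_tile p (ins p) \<noteq> Suc 0 \<and> wt (node_tile p (ins p)) = 1"
proof (cases p)
  case (Strip \<rho> \<pi> u e)
  then have v: "Strip \<rho> \<pi> u e \<in> path_nodes" "Strip \<rho> \<pi> u e \<noteq> seed" using assms I_Strip by auto
  obtain \<rho>' \<pi>' u' e' where l: "par p = Strip \<rho>' \<pi>' u' e'" "linked \<rho> \<pi> u e \<rho>' \<pi>' u' e'"
    using linked_par[OF v] Strip by auto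
  have "rot \<rho>' (out_side (cls \<pi>') u' e' (snd (info \<pi>' u'))) = opp (ins p)"
    using l(2) Strip by (simp add: linked_def)
  then have "unrot \<rho>' (opp (ins p)) = out_side (cls \<pi>') u' e' (snd (info \<pi>' u'))" by (metis unrot_rot)
  then have "node_tile (par p) (opp (ins p)) = enc (child_label \<rho>' (cls \<pi>') u' e' (info \<pi>' u'))"
    unfolding l(1) using l(2) by (intro out_label) (auto simp: linked_def)
  then show ?thesis using in_label[OF v] l(2) Strip by (simp add: linked_def wt_def del: node_tile.simps ins.simps)
next
  case (Fill x y)
  show ?thesis
  proof (cases "x > W")
    case True
    then show ?thesis using Fill by (simp add: wt_def)
  next
    case False
    then have "x = W" using assms Fill by (simp add: I_Fill)
    then show ?thesis using Fill exit_face by (auto simp: wt_def exit_node_def simp del: node_tile.simps(1))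
  qed
qed

text \<open>Filling tiles repeat their glue, so the last one of the column and of each row still
  shows a positive face. It points to the inner boundary column of copy 1 and of copy 2
  respectively, which is already complete.\<close>

lemma faces:
  assumes q: "q \<in> I" and a: "node_tile q d \<noteq> Suc 0" "wt (node_tile q d) = 1"
  shows "(\<exists>r\<in>I. (r, q) \<in> ParI\<^sup>* \<and> npos r = nb (npos q) d) \<or> (\<exists>p\<in>I - {seed}. par p = q \<and> d = opp (ins p))"
proof -
  have a0: "node_tile q d \<noteq> 0" using a by (metis wt_def zero_neq_one)
  have up: "?thesis" if "d = ins q" "q \<noteq> seed"
  proof -
    have "(par q, q) \<in> ParI\<^sup>*" using q that by auto
    then show ?thesis using par_npos[OF q that(2)] par_in_I[OF q that(2)] that by blast
  qed
  show ?thesis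
  proof (cases q)
    case (Strip \<rho> \<pi> u e)
    then have v: "Strip \<rho> \<pi> u e \<in> path_nodes" using q I_Strip by simp
    show ?thesis
    proof (rule Strip_faces[OF v, of d])
      show "node_tile (Strip \<rho> \<pi> u e) d \<noteq> Suc 0" "node_tile (Strip \<rho> \<pi> u e) d \<noteq> 0" using a a0 Strip by auto
    next
      assume "d = ins (Strip \<rho> \<pi> u e)" "Strip \<rho> \<pi> u e \<noteq> seed"
      then have "d = ins q" "q \<noteq> seed" using Strip by simp_all
      then show ?thesis by (rule up)
    next
      assume o: "unrot \<rho> d = out_side (cls \<pi>) u e (snd (info \<pi> u))" "Strip \<rho> \<pi> u e \<noteq> fin_node"
      obtain \<rho>' \<pi>' u' e' where c: "Strip \<rho>' \<pi>' u' e' \<in> path_nodes" "Strip \<rho>' \<pi>' u' e' \<noteq> seed"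
        "par (Strip \<rho>' \<pi>' u' e') = Strip \<rho> \<pi> u e" "linked \<rho>' \<pi>' u' e' \<rho> \<pi> u e"
        by (rule child[OF v o(2)])
      have "d = rot \<rho> (out_side (cls \<pi>) u e (snd (info \<pi> u)))" using o(1) by (metis rot_unrot)
      then have "d = opp (ins (Strip \<rho>' \<pi>' u' e'))" using c(4) by (simp add: linked_def)
      then show ?thesis using c Strip I_Strip by blast
    next
      assume x: "Strip \<rho> \<pi> u e = exit_node" "d = North"
      have "Fill W W \<in> I - {seed}" using N_big by (auto simp: I_Fill W_def seed_def)
      moreover have "par (Fill W W) = q" using x Strip by (simp add: exit_node_def)
      ultimately show ?thesis using x by (intro disjI2 bexI[of _ "Fill W W"]) auto
    qed
  next
    case (Fill x y)
    have xy: "W \<le> x" "x < N - W" "W \<le> y" "y < N - W" using q Fill by (auto simp: I_Fill)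
    have L: "N - W = H + 4 * M" using N_eq by (simp add: W_def)
    have nW: "int N - 1 - int (4 * k + 2) = int (N - W)" using N_big by (simp add: W_def)
    have "q \<noteq> seed" using Fill by (simp add: seed_def)
    consider "d = ins q" | "d = North" "x = W" | "d = East"
      using a0 Fill xy by (auto split: if_splits)
    then show ?thesis
    proof cases
      case 1
      then show ?thesis using up \<open>q \<noteq> seed\<close> by blast
    next
      case 2
      show ?thesis
      proof (cases "Suc y < N - W")
        case True
        then have "Fill x (Suc y) \<in> I - {seed}" "par (Fill x (Suc y)) = q" "d = opp (ins (Fill x (Suc y)))"
          using xy 2 Fill by (auto simp: I_Fill seed_def)
        then show ?thesis by blast
      next
        case False
        have "\<exists>r\<in>I. (r, Fill x y) \<in> ParI\<^sup>* \<and> npos r = rotp 1 (int (4 * k + 2), int x)"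
          using q Fill xy L by (intro strip_before_fill) auto
        moreover have "rotp 1 (int (4 * k + 2), int x) = nb (npos q) d"
          using False 2 Fill xy nW by simp
        ultimately show ?thesis using Fill by auto
      qed
    next
      case 3
      show ?thesis
      proof (cases "Suc x < N - W")
        case True
        then have "Fill (Suc x) y \<in> I - {seed}" "par (Fill (Suc x) y) = q" "d = opp (ins (Fill (Suc x) y))"
          using xy 3 Fill by (auto simp: I_Fill seed_def)
        then show ?thesis by blast
      next
        case False
        have "\<exists>r\<in>I. (r, Fill x y) \<in> ParI\<^sup>* \<and> npos r = rotp 2 (int (4 * k + 2), int N - 1 - int y)"
          using q Fill xy L N_big by (intro strip_before_fill) (auto simp: W_def)
        moreover have "rotp 2 (int (4 * k + 2), int N - 1 - int y) = nb (npos q) d"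
          using False 3 Fill xy nW by (simp add: numeral_2_eq_2)
        ultimately show ?thesis using Fill by auto
      qed
    qed
  qed
qed

lemma path_tile_not_pocket: "\<not> pocket c u e \<Longrightarrow> path_tile \<rho> c u e i r = path_tile \<rho> c u e i r'"
  by (rule ext) (simp add: path_tile_def out_info_def neg_face_def)

text \<open>The parent being in the same pass, all cells of the previous pass, and so both writers,
  are its ancestors.\<close>

lemma pocket_par:
  assumes v: "Strip \<rho> \<pi> u e \<in> path_nodes" and p: "pocket (cls \<pi>) u e"
  shows "\<exists>u' e'. par (Strip \<rho> \<pi> u e) = Strip \<rho> \<pi> u' e'"
proof -
  have b: "\<pi> \<le> 2 * M" "u \<le> 4 * k + 2" using v by (auto simp: path_nodes_iff)
  then have f: "even u" "e = lo \<pi> u" using pocket_lo[OF p b(1)] by auto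
  have "u \<noteq> 4 * k + 2" using pocket_lo[OF p b(1)] b by auto
  then have "u \<noteq> 1" "u \<noteq> 4 * k + 1" "u \<noteq> 4 * k + 2" using f(1) by auto
  then show ?thesis using f by (simp add: hpar_def)
qed

text \<open>A matching glue on the same side cannot be an output of \<open>q\<close>, since the
  child it names has its input on the opposite side. So it is the input of \<open>q\<close>, and the
  tiles can differ only in the bit guessed in a pocket; the wrong guess faces the writer that shows
  the negative glue.\<close>

lemma blocked:
  assumes p: "p \<in> I" "p \<noteq> seed" and q: "q \<in> I" and l: "node_tile q (ins p) = node_tile p (ins p)" and ne: "node_tile q \<noteq> node_tile p"
  shows "\<exists>d r. r \<in> I \<and> (r, par p) \<in> ParI\<^sup>* \<and> npos r = nb (npos p) d \<and> node_tile q d = Suc 0 \<and> node_tile r (opp d) = Suc 0"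
proof -
  have al: "node_tile q (ins p) \<noteq> Suc 0" "node_tile q (ins p) \<noteq> 0" using edge[OF p] l by (metis, metis wt_def zero_neq_one)
  have qc: "(\<exists>\<rho>1 c1 u1 e1 i1. \<rho>1 < 4 \<and> node_tile q (ins p) = enc (\<rho>1, c1, u1, e1, i1)) \<or> q = exit_node \<and> ins p = North"
    if "q = Strip \<rho>' \<pi>' u' e'" for \<rho>' \<pi>' u' e'
  proof -
    have v': "Strip \<rho>' \<pi>' u' e' \<in> path_nodes" using that q I_Strip by simp
    show ?thesis
    proof (rule Strip_faces[OF v', of "ins p"])
      show "node_tile (Strip \<rho>' \<pi>' u' e') (ins p) \<noteq> Suc 0" "node_tile (Strip \<rho>' \<pi>' u' e') (ins p) \<noteq> 0" using al that by auto
    next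
      assume "ins p = ins (Strip \<rho>' \<pi>' u' e')" "Strip \<rho>' \<pi>' u' e' \<noteq> seed"
      then show ?thesis using in_label[OF v'] that v' path_nodes_iff by metis
    next
      assume o: "Strip \<rho>' \<pi>' u' e' \<noteq> fin_node" "node_tile (Strip \<rho>' \<pi>' u' e') (ins p) = enc (child_label \<rho>' (cls \<pi>') u' e' (info \<pi>' u'))"
      obtain \<rho>1 \<pi>1 u1 e1 where "Strip \<rho>1 \<pi>1 u1 e1 \<in> path_nodes" "Strip \<rho>1 \<pi>1 u1 e1 \<noteq> seed"
        "par (Strip \<rho>1 \<pi>1 u1 e1) = Strip \<rho>' \<pi>' u' e'" "linked \<rho>1 \<pi>1 u1 e1 \<rho>' \<pi>' u' e'"
        by (rule child[OF v' o(1)])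
      then have "child_label \<rho>' (cls \<pi>') u' e' (info \<pi>' u') = (\<rho>1, cls \<pi>1, u1, e1, ininfo \<pi>1 u1 e1)" "\<rho>1 < 4"
        by (auto simp: linked_def path_nodes_iff)
      then show ?thesis using o(2) that by auto
    qed (use that in auto)
  qed
  show ?thesis
  proof (cases p)
    case (Fill x y)
    have pf: "node_tile p (ins p) = enc (if x > W then 5 else 4, 0, 0, 0, False, False)" "ins p \<noteq> North"
      using Fill p by (auto simp: I_Fill)
    show ?thesis
    proof (cases q)
      case Q: (Strip \<rho>' \<pi>' u' e')
      then show ?thesis using qc[OF Q] pf l by (auto split: if_splits simp del: node_tile.simps)
    next
      case Q: (Fill x' y')
      then have "(x' = W) = (x = W)" using l Fill p(1) q by (auto simp: I_Fill split: if_splits)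
      then have "node_tile q = node_tile p" using Q Fill by simp
      then show ?thesis using ne by simp
    qed
  next
    case (Strip \<rho> \<pi> u e)
    then have v: "Strip \<rho> \<pi> u e \<in> path_nodes" "Strip \<rho> \<pi> u e \<noteq> seed" using p I_Strip by auto
    then have \<rho>4: "\<rho> < 4" by (simp add: path_nodes_iff)
    have lab: "node_tile q (ins p) = enc (\<rho>, cls \<pi>, u, e, ininfo \<pi> u e)" using l in_label[OF v] Strip by simp
    obtain \<rho>' \<pi>' u' e' where Q: "q = Strip \<rho>' \<pi>' u' e'"
      using lab \<rho>4 by (cases q) (auto split: if_splits)
    have v': "Strip \<rho>' \<pi>' u' e' \<in> path_nodes" using Q q I_Strip by simp
    have nx: "q \<noteq> exit_node \<or> ins p \<noteq> North" using lab exit_face \<rho>4 by auto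
    consider "ins p = ins q" "q \<noteq> seed"
      | "unrot \<rho>' (ins p) = out_side (cls \<pi>') u' e' (snd (info \<pi>' u'))" "q \<noteq> fin_node"
        "node_tile q (ins p) = enc (child_label \<rho>' (cls \<pi>') u' e' (info \<pi>' u'))"
      by (rule Strip_faces[OF v', of "ins p"])
        (use al Q nx in \<open>auto simp del: node_tile.simps ins.simps\<close>)
    then show ?thesis
    proof cases
      case 2
      obtain \<rho>1 \<pi>1 u1 e1 where "Strip \<rho>1 \<pi>1 u1 e1 \<in> path_nodes" "Strip \<rho>1 \<pi>1 u1 e1 \<noteq> seed"
        "par (Strip \<rho>1 \<pi>1 u1 e1) = Strip \<rho>' \<pi>' u' e'" and c: "linked \<rho>1 \<pi>1 u1 e1 \<rho>' \<pi>' u' e'"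
        by (rule child[OF v' 2(2)[unfolded Q]])
      then have "\<rho>1 = \<rho>" "cls \<pi>1 = cls \<pi>" "u1 = u" "e1 = e"
        using lab 2(3) by (auto simp: linked_def)
      then have "rot \<rho>1 (in_side (cls \<pi>1) u1 e1 (snd (info \<pi>1 u1))) = ins p"
        using Strip in_side_indep[of "cls \<pi>" u e "snd (info \<pi>1 u)" "snd (info \<pi> u)"] by simp
      then have "rot \<rho>' (out_side (cls \<pi>') u' e' (snd (info \<pi>' u'))) = opp (ins p)"
        using c by (simp add: linked_def)
      moreover have "rot \<rho>' (out_side (cls \<pi>') u' e' (snd (info \<pi>' u'))) = ins p"
        using 2(1) by (metis rot_unrot)
      ultimately show ?thesis using opp_neq by metis
    next
      case 1
      then have "node_tile q (ins p) = enc (\<rho>', cls \<pi>', u', e', ininfo \<pi>' u' e')"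
        using in_label[OF v'] Q by metis
      then have eq: "\<rho>' = \<rho>" "cls \<pi>' = cls \<pi>" "u' = u" "e' = e" "ininfo \<pi>' u' e' = ininfo \<pi> u e"
        using lab by auto
      have pk: "pocket (cls \<pi>) u e"
      proof (rule ccontr)
        assume "\<not> ?thesis"
        then have "node_tile q = node_tile p" using eq Q Strip path_tile_not_pocket[of "cls \<pi>" u e \<rho> "ininfo \<pi> u e" "read_bit \<pi>' u" "read_bit \<pi> u"] by simp
        then show False using ne by simp
      qed
      have read_bit: "read_bit \<pi>' u \<noteq> read_bit \<pi> u"
      proof
        assume "read_bit \<pi>' u = read_bit \<pi> u"
        then have "node_tile q = node_tile p" using eq Q Strip by simp
        then show False using ne by simp
      qed
      obtain u1 e1 u2 e2 where E: "Strip \<rho> (\<pi> - 1) u1 e1 \<in> path_nodes" "Strip \<rho> (\<pi> - 1) u2 e2 \<in> path_nodes" "0 < \<pi>"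
        "lpos (\<pi> - 1) u1 e1 = nb (lpos \<pi> u e) South" "lpos (\<pi> - 1) u2 e2 = nb (lpos \<pi> u e) (wall \<pi>)"
        "node_tile (Strip \<rho> (\<pi> - 1) u1 e1) (rot \<rho> North) = Suc 0 \<longleftrightarrow> \<not> read_bit \<pi> u"
        "node_tile (Strip \<rho> (\<pi> - 1) u2 e2) (rot \<rho> (opp (wall \<pi>))) = Suc 0 \<longleftrightarrow> read_bit \<pi> u"
        using pocket_nbs[OF v(1) pk] by blast
      obtain u3 e3 where pp: "par p = Strip \<rho> \<pi> u3 e3" using pocket_par[OF v(1) pk] Strip by blast
      have ppi: "par p \<in> path_nodes" using linked_parD(1)[of p] v Strip by simp
      have anc: "(Strip \<rho> (\<pi> - 1) u' e', par p) \<in> ParI\<^sup>*" if "Strip \<rho> (\<pi> - 1) u' e' \<in> path_nodes" for u' e'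
        using that ppi E(3) by (intro key_anc) (auto simp: pp)
      \<comment> \<open>A pocket is entered horizontally from the side opposite the wall and left
        upwards, as its column has further cells; so the two reader faces are free for the negative
        glue.\<close>
      have io: "in_side (cls \<pi>') u e (snd (info \<pi>' u)) \<noteq> d" "out_side (cls \<pi>') u e (snd (info \<pi>' u)) \<noteq> d"
        if "d = South \<or> d = wall \<pi>" for d
      proof -
        have \<pi>': "\<pi>' \<le> 2 * M" "u \<le> 4 * k + 2" "odd \<pi>' = odd \<pi>"
          using v' eq by (auto simp: path_nodes_iff simp flip: cls_odd(2))
        have "u < 4 * k + 2" "even u" "e = lo \<pi>' u"
          using pocket_lo[of \<pi>' u e] pk eq \<pi>' by auto
        moreover have "Suc e \<noteq> hi \<pi>' u"
          using pk eq \<pi>' lo_hi_odd[of \<pi>' u] lo_hi_even[of \<pi>' u] \<open>u < 4 * k + 2\<close> zag_floor_def[of u] zig_floor_def[of u]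
          by (auto simp: pocket_def cls_def split: if_splits)
        ultimately show "in_side (cls \<pi>') u e (snd (info \<pi>' u)) \<noteq> d" "out_side (cls \<pi>') u e (snd (info \<pi>' u)) \<noteq> d"
          unfolding in_side_eq out_side_eq Let_def using that \<pi>' by (auto simp: wall_def)
      qed
      show ?thesis
      proof (cases "read_bit \<pi> u")
        case False
        then have "neg_face (cls \<pi>') u e (info \<pi>' u) (read_bit \<pi>' u) South"
          using read_bit pk eq by (simp add: neg_face_def)
        then have "node_tile q (rot \<rho> South) = Suc 0"
          using node_tile_neg_iff[OF v', of South] io[of South] eq Q by simp
        moreover have "node_tile (Strip \<rho> (\<pi> - 1) u1 e1) (opp (rot \<rho> South)) = Suc 0"
          using E(6) False by (simp flip: rot_opp del: node_tile.simps)
        moreover have "npos (Strip \<rho> (\<pi> - 1) u1 e1) = nb (npos p) (rot \<rho> South)"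
          using E(4) Strip by (simp add: rotp_nb del: nb.simps)
        ultimately show ?thesis using anc[OF E(1)] E(1) I_Strip by blast
      next
        case True
        then have "neg_face (cls \<pi>') u e (info \<pi>' u) (read_bit \<pi>' u) (wall \<pi>)"
          using read_bit pk eq by (simp add: neg_face_def wall_def cls_odd)
        then have "node_tile q (rot \<rho> (wall \<pi>)) = Suc 0"
          using node_tile_neg_iff[OF v', of "wall \<pi>"] io[of "wall \<pi>"] eq Q by simp
        moreover have "node_tile (Strip \<rho> (\<pi> - 1) u2 e2) (opp (rot \<rho> (wall \<pi>))) = Suc 0"
          using E(7) True by (simp flip: rot_opp del: node_tile.simps)
        moreover have "npos (Strip \<rho> (\<pi> - 1) u2 e2) = nb (npos p) (rot \<rho> (wall \<pi>))"
          using E(5) Strip by (simp add: rotp_nb del: nb.simps)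
        ultimately show ?thesis using anc[OF E(2)] E(2) I_Strip by blast
      qed
    qed
  qed
qed

sublocale tree_tas I npos node_tile par ins seed wt "Suc 0"
proof
  show "finite I" by (rule finite_I)
  show "seed \<in> I" using seed_in by (simp add: I_def)
  show "inj_on npos I" by (rule inj_npos)
  show "wt g \<in> {0, 1}" for g by (simp add: wt_def)
  show "wf ParI" by (rule wf_ParI)
  show "p \<in> I \<Longrightarrow> q \<in> I \<Longrightarrow> npos q = nb (npos p) d \<Longrightarrow> node_tile p d = Suc 0 \<Longrightarrow> node_tile q (opp d) \<noteq> Suc 0" for p q d
    using no_conflict_Strip by blast
qed (fact par_in_I par_npos edge faces blocked)+

lemma neg_used: "Suc 0 \<in> glues_of (node_tile ` I)"
proof -
  have "Strip 0 1 2 0 \<in> path_nodes" using M1 k1 lo_hi_odd[of 1 2] by (simp add: path_nodes_iff zig_floor_def zag_floor_def)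
  moreover have "pocket (cls 1) 2 0" using k1 cls_simps(3)[of 1] by (simp add: pocket_def)
  ultimately obtain u1 e1 u2 e2 where "Strip 0 (1 - 1) u1 e1 \<in> path_nodes" "Strip 0 (1 - 1) u2 e2 \<in> path_nodes"
    "node_tile (Strip 0 (1 - 1) u1 e1) (rot 0 North) = Suc 0 \<longleftrightarrow> \<not> read_bit 1 2"
    "node_tile (Strip 0 (1 - 1) u2 e2) (rot 0 (opp (wall 1))) = Suc 0 \<longleftrightarrow> read_bit 1 2"
    using pocket_nbs[of 0 1 2 0] by blast
  then have "\<exists>p\<in>I. \<exists>d. node_tile p d = Suc 0" using I_Strip by (cases "read_bit 1 2") blast+
  then show ?thesis unfolding glues_of_def by (metis (mono_tags, lifting) imageI mem_Collect_eq)
qed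

text \<open>The factor 128 counts 4 copies, 4 classes, 4 values of the information and 2 guessed
  bits; \<open>H + 7\<close> bounds the heights \<open>H + 3\<close> of the initial and 7 of the
  leftward passes; the last 2 are the filling tiles.\<close>

lemma card_tiles: "card (node_tile ` I) \<le> 128 * (W * (H + 7)) + 2"
proof -
  let ?f = "\<lambda>(\<rho>, c, u, e, i, r) d. path_tile \<rho> c u e i r (unrot \<rho> d)"
  let ?X = "{..<4::nat} \<times> {..<4::nat} \<times> {..<W} \<times> {..<H + 7} \<times> (UNIV :: (bool \<times> bool) set) \<times> (UNIV :: bool set)"
  have "node_tile ` I \<subseteq> ?f ` ?X \<union> {node_tile (Fill W 0), node_tile (Fill (Suc W) 0)}"
  proof (rule image_subsetI)
    fix p assume p: "p \<in> I"
    show "node_tile p \<in> ?f ` ?X \<union> {node_tile (Fill W 0), node_tile (Fill (Suc W) 0)}"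
    proof (cases p)
      case (Strip \<rho> \<pi> u e)
      then have b: "\<rho> < 4" "\<pi> \<le> 2 * M" "u < W" "u \<le> 4 * k + 2" "e < hi \<pi> u" using p by (auto simp: I_Strip path_nodes_iff W_def)
      have "zig_floor u \<le> 3" "zag_floor u \<le> 5" by (auto simp: zig_floor_def zag_floor_def)
      then have "e < H + 7"
        using b(5) lo_hi_odd[of \<pi> u] b(2)
        by (cases rule: pass_cases[OF b(2)]) (auto simp: lo_hi_0 lo_hi_even lo_hi_fin split: if_splits)
      moreover have "cls \<pi> < 4" by (simp add: cls_def)
      ultimately have "(\<rho>, cls \<pi>, u, e, ininfo \<pi> u e, read_bit \<pi> u) \<in> ?X" using b by simp
      moreover have "node_tile p = ?f (\<rho>, cls \<pi>, u, e, ininfo \<pi> u e, read_bit \<pi> u)" using Strip by simp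
      ultimately show ?thesis by blast
    next
      case (Fill x y)
      then show ?thesis by (cases "x = W") auto
    qed
  qed
  then have "card (node_tile ` I) \<le> card (?f ` ?X \<union> {node_tile (Fill W 0), node_tile (Fill (Suc W) 0)})"
    by (intro card_mono) auto
  also have "\<dots> \<le> card (?f ` ?X) + card {node_tile (Fill W 0), node_tile (Fill (Suc W) 0)}" by (rule card_Un_le)
  also have "\<dots> \<le> card ?X + 2" by (intro add_mono card_image_le card_insert_le_m1) auto
  also have "card ?X = 128 * (W * (H + 7))"
    by (simp add: card_cartesian_product card_UNIV_bool flip: UNIV_Times_UNIV)
  finally show ?thesis by simp
qed

end

section \<open>Squares of all sizes\<close>

definition good_system :: "nat \<Rightarrow> tile set \<Rightarrow> bool" where
  "good_system N T \<longleftrightarrow> (\<exists>s p w neg. finite T \<and> s \<in> T \<and> (\<forall>g. w g \<in> {0, 1}) \<and> neg \<in> glues_of T \<and>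
     (\<forall>m::nat. m \<ge> 1 \<longrightarrow> directed T (prg_str w neg m) 1 [p \<mapsto> s] \<and>
        strictly_self_assembles T (prg_str w neg m) 1 [p \<mapsto> s] (square N)))"

lemma (in counter) good_counter: "good_system N (node_tile ` I)"
  unfolding good_system_def
  by (rule exI[of _ "node_tile seed"], rule exI[of _ "npos seed"], rule exI[of _ wt], rule exI[of _ "Suc 0"])
    (use finite_I s_in neg_used w01 tree_directed in \<open>auto simp flip: npos_image\<close>)

text \<open>One tile type per cell; the tree is a comb whose spine is the western column.\<close>

lemma good_system_small:
  assumes "N \<ge> 1"
  shows "\<exists>T. good_system N T \<and> card T \<le> N * N"
proof -
  define I where "I = {..<N} \<times> {..<N}"
  define npos where "npos p = (int (fst p), int (snd p))" for p :: "nat \<times> nat"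
  define par where "par p = (if fst p > 0 then (fst p - 1, snd p) else (0, snd p - 1))" for p :: "nat \<times> nat"
  define ins where "ins p = (if fst p > 0 then West else South)" for p :: "nat \<times> nat"
  define L where "L x y = enc (x, y, 0, 0, False, False)" for x y
  \<comment> \<open>The South face of the origin looks out of the square; its negative glue is there
    only so that the system contains one.\<close>
  define node_tile where "node_tile p d = (let x = fst p; y = snd p in case d of
      West \<Rightarrow> if x > 0 then L x y else 0
    | South \<Rightarrow> if x > 0 then 0 else if y > 0 then L x y else Suc 0
    | East \<Rightarrow> if Suc x < N then L (Suc x) y else 0
    | North \<Rightarrow> if x = 0 \<and> Suc y < N then L 0 (Suc y) else 0)" for p :: "nat \<times> nat" and d
  have L: "L x y = L x' y' \<longleftrightarrow> x = x' \<and> y = y'" "L x y \<noteq> 0" "L x y \<noteq> Suc 0" "Suc 0 \<noteq> L x y" "wt (L x y) = 1" for x y x' y'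
    by (auto simp: L_def wt_def)
  interpret tree_tas I npos node_tile par ins "(0, 0)" wt "Suc 0"
  proof
    show "finite I" by (simp add: I_def)
    show "(0, 0) \<in> I" using assms by (simp add: I_def)
    show "inj_on npos I" by (auto simp: inj_on_def npos_def)
    show "wt g \<in> {0, 1}" for g by (simp add: wt_def)
    show "wf {(par p, p) |p. p \<in> I - {(0, 0)}}"
      by (rule wf_subset[OF wf_measure[of "\<lambda>p. fst p + snd p"]]) (auto simp: par_def)
    show "par p \<in> I" if "p \<in> I" "p \<noteq> (0, 0)" for p using that by (auto simp: I_def par_def)
    show "npos (par p) = nb (npos p) (ins p)" if "p \<in> I" "p \<noteq> (0, 0)" for p
      using that by (cases p) (auto simp: npos_def par_def ins_def)
    show "node_tile (par p) (opp (ins p)) = node_tile p (ins p) \<and> node_tile p (ins p) \<noteq> Suc 0 \<and> wt (node_tile p (ins p)) = 1"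
      if "p \<in> I" "p \<noteq> (0, 0)" for p
      using that by (cases p) (auto simp: node_tile_def par_def ins_def I_def L)
    show "(\<exists>r\<in>I. (r, q) \<in> {(par p, p) |p. p \<in> I - {(0, 0)}}\<^sup>* \<and> npos r = nb (npos q) d) \<or>
       (\<exists>p\<in>I - {(0, 0)}. par p = q \<and> d = opp (ins p))"
      if q: "q \<in> I" and a: "node_tile q d \<noteq> Suc 0" "wt (node_tile q d) = 1" for q d
    proof -
      obtain x y where xy: "q = (x, y)" by (cases q)
      consider "q \<noteq> (0, 0)" "d = ins q" | "d = East" "Suc x < N" | "d = North" "x = 0" "Suc y < N"
        using a xy by (cases d) (auto simp: node_tile_def ins_def wt_def split: if_splits)
      then show ?thesis
      proof cases
        case 1
        then have "(par q, q) \<in> {(par p, p) |p. p \<in> I - {(0, 0)}}\<^sup>*" "par q \<in> I" "npos (par q) = nb (npos q) d"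
          using q xy by (auto simp: I_def npos_def par_def ins_def)
        then show ?thesis by blast
      next
        case 2
        then show ?thesis using q xy by (intro disjI2 bexI[of _ "(Suc x, y)"]) (auto simp: I_def par_def ins_def)
      next
        case 3
        then show ?thesis using q xy by (intro disjI2 bexI[of _ "(x, Suc y)"]) (auto simp: I_def par_def ins_def)
      qed
    qed
    show "node_tile q (opp d) \<noteq> Suc 0" if "npos q = nb (npos p) d" "node_tile p d = Suc 0" "q \<in> I" for p q d
      using that by (cases d) (auto simp: node_tile_def npos_def L Let_def split: if_splits)
    show "\<exists>d r. r \<in> I \<and> (r, par p) \<in> {(par p, p) |p. p \<in> I - {(0, 0)}}\<^sup>* \<and> npos r = nb (npos p) d \<and>
        node_tile q d = Suc 0 \<and> node_tile r (opp d) = Suc 0"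
      if "p \<in> I" "p \<noteq> (0, 0)" "q \<in> I" "node_tile q (ins p) = node_tile p (ins p)" "node_tile q \<noteq> node_tile p" for p q
    proof -
      have "q = p" using that by (cases p; cases q) (auto simp: node_tile_def ins_def L split: if_splits)
      then show ?thesis using that by simp
    qed
  qed
  have im: "npos ` I = square N"
  proof
    show "npos ` I \<subseteq> square N" by (auto simp: npos_def I_def square_def)
    show "square N \<subseteq> npos ` I"
    proof
      fix z assume "z \<in> square N"
      then show "z \<in> npos ` I"
        by (intro image_eqI[of _ _ "(nat (fst z), nat (snd z))"]) (auto simp: npos_def I_def square_def)
    qed
  qed
  have "node_tile (0, 0) South = Suc 0" by (simp add: node_tile_def)
  then have "Suc 0 \<in> glues_of (node_tile ` I)" using s_in unfolding glues_of_def by (metis (mono_tags, lifting) imageI mem_Collect_eq)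
  then have "good_system N (node_tile ` I)"
    unfolding good_system_def
    by (intro exI[of _ "node_tile (0, 0)"] exI[of _ "npos (0, 0)"] exI[of _ wt] exI[of _ "Suc 0"])
      (use fin s_in w01 tree_directed in \<open>auto simp flip: im\<close>)
  moreover have "card (node_tile ` I) \<le> N * N"
    using card_image_le[OF fin, of node_tile] by (simp add: I_def card_cartesian_product)
  ultimately show ?thesis by blast
qed

section \<open>Choice of parameters\<close>

lemma counter_length: "k \<ge> 7 \<Longrightarrow> 8 * k + 6 \<le> 2 ^ (k - 1)" for k :: nat
proof (induction k rule: dec_induct)
  case (step n)
  then have "(2::nat) ^ (Suc n - 1) = 2 * 2 ^ (n - 1)" by (cases n) auto
  then show ?case using step by simp
qed simp

lemma good_system_large:
  assumes N: "N \<ge> 64"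
  shows "\<exists>T. good_system N T \<and> real (card T) \<le> 20000 * log 2 (real N)"
proof -
  define k where "k = (LEAST k. N \<le> 2 ^ k)"
  have Nk: "N \<le> 2 ^ k" unfolding k_def by (rule LeastI[of _ N]) (simp add: less_exp less_imp_le)
  have "(2::nat) ^ 5 < 2 ^ k" using N Nk by simp
  then have k6: "k \<ge> 6" using power_less_imp_less_exp[of "2::nat" 5 k] by simp
  have lk: "2 ^ (k - 1) < N"
    using not_less_Least[of "k - 1" "\<lambda>k. N \<le> 2 ^ k"] k6 by (simp add: k_def[symmetric])
  \<comment> \<open>For \<open>k = 6\<close> the bound of \<open>counter_length\<close> fails, but
    54 is below 64; this is where the threshold for \<open>N\<close> comes from.\<close>
  have big: "8 * k + 6 < N"
    using counter_length[of k] lk N k6 by (cases "k = 6") auto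
  define R where "R = N - (4 * k + 3)"
  \<comment> \<open>Dividing \<open>R - 1\<close> instead of \<open>R\<close> puts the remainder
    \<open>H\<close> between 1 and 4, so the initial pass is never empty.\<close>
  define M where "M = (R - 1) div 4"
  define H where "H = R - 4 * M"
  have R5: "R \<ge> 5" using big k6 by (simp add: R_def)
  have H: "1 \<le> H" "H \<le> 4" "R = H + 4 * M" "1 \<le> M" using R5 unfolding H_def M_def by presburger+
  interpret counter k M H N
  proof
    have "M \<le> N" using H R_def by simp
    then show "M \<le> 2 ^ k" using Nk by simp
    show "N = 4 * k + 3 + (H + 4 * M)" using H big by (simp add: R_def)
  qed (use H k6 big in auto)
  have "card (node_tile ` I) \<le> 128 * (W * (H + 7)) + 2" by (rule card_tiles)
  also have "\<dots> \<le> 128 * (W * 11) + 2" using H by (intro add_mono mult_mono) auto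
  also have "\<dots> \<le> 10000 * k" using k6 by (simp add: W_def)
  finally have c: "real (card (node_tile ` I)) \<le> 10000 * real k" by (metis of_nat_le_iff of_nat_mult of_nat_numeral)
  obtain n where n: "k = Suc n" using k6 by (cases k) auto
  have "real (2 ^ n) \<le> real N" using lk n by (simp only: of_nat_le_iff) simp
  then have "2 powr real n \<le> real N" by (simp add: powr_realpow)
  then have "real n \<le> log 2 (real N)" using N by (simp add: le_log_iff)
  moreover have "real k = real n + 1" "real n \<ge> 1" using n k6 by simp_all
  \<comment> \<open>Minimality of \<open>k\<close> gives \<open>k - 1 \<le> log 2 N\<close>, and
    \<open>k \<le> 2 * (k - 1)\<close>; this doubles 10000 to 20000.\<close>
  ultimately have "real k \<le> 2 * log 2 (real N)" by linarith
  then have "real (card (node_tile ` I)) \<le> 20000 * log 2 (real N)" using c by linarith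
  then show ?thesis by (intro exI[of _ "node_tile ` I"] conjI good_counter)
qed

theorem theorem2:
  shows "\<exists>C::real. \<forall>N::nat. N \<ge> 2 \<longrightarrow>
    (\<exists>(T::tile set) (s::tile) (p::pos) (w::nat \<Rightarrow> int) (neg::nat).
       finite T \<and> s \<in> T \<and>
       (\<forall>g. w g \<in> {0, 1}) \<and> neg \<in> glues_of T \<and>
       real (card T) \<le> C * log 2 (real N) \<and>
       (\<forall>m::nat. m \<ge> 1 \<longrightarrow>
          directed T (prg_str w neg m) 1 [p \<mapsto> s] \<and>
          strictly_self_assembles T (prg_str w neg m) 1 [p \<mapsto> s] (square N)))"
proof -
  have "\<exists>T. good_system N T \<and> real (card T) \<le> 20000 * log 2 (real N)" if N: "N \<ge> 2" for N
  proof (cases "N \<ge> 64")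
    case True
    then show ?thesis by (rule good_system_large)
  next
    case False
    obtain T where T: "good_system N T" "card T \<le> N * N" using good_system_small[of N] N by auto
    have "N * N \<le> 64 * 64" using False by (intro mult_mono) auto
    then have "real (card T) \<le> 20000" using T(2) by linarith
    moreover have "log 2 (real N) \<ge> 1" using N by (subst le_log_iff) auto
    ultimately show ?thesis using T(1) by (intro exI[of _ T]) auto
  qed
  then show ?thesis unfolding good_system_def by (intro exI[of _ 20000]) metis
qed

end
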